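(* For every $\beta>0$ there exists $\varepsilon_0>0$ (depending only on $\beta$) such that the following holds. Suppose $v_2,v_3$ satisfy (i$_2$)–(iii$_2$) and (i$_3$)–(iv$_3$) for some $0<\varepsilon<\varepsilon_0$. Then there exists $N_\beta\in\mathbb{N}$ such that for every $N\ge N_\beta$ and every configuration $C_N$ of $N$ particles, $$\mathcal{F}_\beta(C_N)\ \ge\ -2N+\tfrac12\, m_\beta(N).$$ Moreover, if equality holds, then $C_N\subset \mathbb{Z}^2\cap\{x_2>0\}$ and $\#\big(C_N\cap\{x_2=1\}\big)\ge N/h_*(\beta,N)$.
   Context: Substrate: $\mathcal{L}^-=\mathbb{Z}^2\cap\{x_2\le 0\}$. A configuration of $N$ particles is a set $C_N=\{x_1,\dots,x_N\}$ of $N$ distinct points of $\{x\in\mathbb{R}^2:x_2>0\}$. For points $x,y,z$, $\theta_{x,y,z}\in[0,2\pi)$ is the angle formed by the vectors $x-y$ and $z-y$, measured clockwise. Given $\beta>0$ and $\varepsilon>0$, the potentials $v_2:[0,\infty)\to\mathbb{R}\cup\{+\infty\}$, $v_3:[0,2\pi]\to\mathbb{R}$ are required to satisfy: (i$_2$) $\min_{r\ge0}v_2(r)=v_2(1)=-1$ and $v_2(r)>-1$ for $r\ne1$; (ii$_2$) there is $r_0\in(1,\sqrt2)$ with $v_2(r)=0$ for all $r\ge r_0$; (iii$_2$) $v_2(r)>\varepsilon^{-1}$ for all $r\in[0,1-\varepsilon]$; (i$_3$) $v_3(\theta)=v_3(2\pi-\theta)$ for all $\theta$; (ii$_3$) $v_3(k\pi/2)=0$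 for $k=1,2,3$ and $v_3(\theta)>0$ for $\theta\notin\{\pi/2,\pi,3\pi/2\}$; (iii$_3$) $v_3(\theta)\ge 4(\pi/10-\varepsilon)^{-1}|\theta-\pi|$ for all $\theta\in[\pi-\varepsilon,\pi+\varepsilon]$, with equality only at $\theta=\pi$; (iv$_3$) if $\theta\notin[\pi/2-\varepsilon,\pi/2+\varepsilon]\cup[\pi-\varepsilon,\pi+\varepsilon]\cup[3\pi/2-\varepsilon,3\pi/2+\varepsilon]$ then $v_3(\theta)>\max\{1,2\beta\}\frac{4}{(1-\varepsilon)^2}(\sqrt2+\tfrac12)^2$. Energy: $$\mathcal{F}_\beta(C_N)=\frac12\sum_{x_i\ne x_j\in C_N}v_2(|x_i-x_j|)+\beta\sum_{x_i\in C_N,\,z\in\mathcal{L}^-}v_2(|x_i-z|)+\frac12\sum_{(x,y,z)}v_3(\theta_{x,y,z}),$$ the last sum over triples of pairwise distinct points of $C_N\cup\mathcal{L}^-$ with $|x-y|<r_0$, $|y-z|<r_0$. Define $$m_\beta(N)=\min_{h\in\{1,\dots,N\}}\Big(2h+2(1-\beta)\Big\lceil\frac Nh\Big\rceil\Big),\qquad h_*(\beta,N)=\max\Big\{h\in\{1,\dots,N\}:2h+2(1-\beta)\Big\lceil\frac Nh\Big\rceil=m_\beta(N)\Big\}.$$ *)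

theory Defs
  imports "HOL-Analysis.Analysis"
begin

text \<open>Points of the plane R^2 are modelled as complex numbers: x = (Re x, Im x), so x_2 = Im x.\<close>

definition lattice :: "complex set" where
  "lattice = {x. Re x \<in> \<int> \<and> Im x \<in> \<int>}"

definition substrate :: "complex set" where
  "substrate = {z \<in> lattice. Im z \<le> 0}"

definition is_config :: "nat \<Rightarrow> complex set \<Rightarrow> bool" where
  "is_config N C \<longleftrightarrow> finite C \<and> card C = N \<and> (\<forall>x\<in>C. Im x > 0)"

text \<open>Clockwise angle in [0, 2pi) from the vector x - y to the vector z - y.\<close>
definition theta :: "complex \<Rightarrow> complex \<Rightarrow> complex \<Rightarrow> real" where
  "theta x y z = (let t = Arg ((x - y) / (z - y)) in if t < 0 then t + 2 * pi else t)"

definition triples :: "real \<Rightarrow> complex set \<Rightarrow> (complex \<times> complex \<times> complex) set" where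
  "triples r0 C = {(x, y, z). x \<in> C \<union> substrate \<and> y \<in> C \<union> substrate \<and> z \<in> C \<union> substrate
      \<and> x \<noteq> y \<and> y \<noteq> z \<and> x \<noteq> z \<and> cmod (x - y) < r0 \<and> cmod (y - z) < r0}"

definition energy :: "(real \<Rightarrow> ereal) \<Rightarrow> (real \<Rightarrow> real) \<Rightarrow> real \<Rightarrow> real \<Rightarrow> complex set \<Rightarrow> ereal" where
  "energy v2 v3 r0 \<beta> C =
     ereal (1/2) * (\<Sum>x\<in>C. \<Sum>y\<in>C - {x}. v2 (cmod (x - y)))
   + ereal \<beta> * (\<Sum>x\<in>C. infsum (\<lambda>z. v2 (cmod (x - z))) substrate)
   + ereal (1/2 * infsum (\<lambda>(x, y, z). v3 (theta x y z)) (triples r0 C))"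

definition mval :: "real \<Rightarrow> nat \<Rightarrow> nat \<Rightarrow> real" where
  "mval \<beta> N h = 2 * real h + 2 * (1 - \<beta>) * real (nat \<lceil>real N / real h\<rceil>)"

definition m_beta :: "real \<Rightarrow> nat \<Rightarrow> real" where
  "m_beta \<beta> N = Min ((mval \<beta> N) ` {1..N})"

definition h_star :: "real \<Rightarrow> nat \<Rightarrow> nat" where
  "h_star \<beta> N = Max {h \<in> {1..N}. mval \<beta> N h = m_beta \<beta> N}"

definition pot_conditions :: "real \<Rightarrow> real \<Rightarrow> real \<Rightarrow> (real \<Rightarrow> ereal) \<Rightarrow> (real \<Rightarrow> real) \<Rightarrow> bool" where
  "pot_conditions \<beta> \<epsilon> r0 v2 v3 \<longleftrightarrow>
     \<comment> \<open>(i_2)\<close>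
     v2 1 = -1 \<and> (\<forall>r\<ge>0. v2 r \<ge> -1) \<and> (\<forall>r\<ge>0. r \<noteq> 1 \<longrightarrow> v2 r > -1) \<and>
     \<comment> \<open>(ii_2)\<close>
     1 < r0 \<and> r0 < sqrt 2 \<and> (\<forall>r\<ge>r0. v2 r = 0) \<and>
     \<comment> \<open>(iii_2)\<close>
     (\<forall>r. 0 \<le> r \<and> r \<le> 1 - \<epsilon> \<longrightarrow> v2 r > ereal (1 / \<epsilon>)) \<and>
     \<comment> \<open>(i_3)\<close>
     (\<forall>\<theta>. 0 \<le> \<theta> \<and> \<theta> \<le> 2 * pi \<longrightarrow> v3 \<theta> = v3 (2 * pi - \<theta>)) \<and>
     \<comment> \<open>(ii_3)\<close>
     v3 (pi / 2) = 0 \<and> v3 pi = 0 \<and> v3 (3 * pi / 2) = 0 \<and>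
     (\<forall>\<theta>. 0 \<le> \<theta> \<and> \<theta> \<le> 2 * pi \<and> \<theta> \<notin> {pi / 2, pi, 3 * pi / 2} \<longrightarrow> v3 \<theta> > 0) \<and>
     \<comment> \<open>(iii_3)\<close>
     (\<forall>\<theta>. pi - \<epsilon> \<le> \<theta> \<and> \<theta> \<le> pi + \<epsilon> \<longrightarrow> v3 \<theta> \<ge> 4 / (pi / 10 - \<epsilon>) * \<bar>\<theta> - pi\<bar>) \<and>
     (\<forall>\<theta>. pi - \<epsilon> \<le> \<theta> \<and> \<theta> \<le> pi + \<epsilon> \<and> \<theta> \<noteq> pi \<longrightarrow> v3 \<theta> > 4 / (pi / 10 - \<epsilon>) * \<bar>\<theta> - pi\<bar>) \<and>
     \<comment> \<open>(iv_3)\<close>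
     (\<forall>\<theta>. 0 \<le> \<theta> \<and> \<theta> \<le> 2 * pi \<and>
        \<theta> \<notin> {pi/2 - \<epsilon> .. pi/2 + \<epsilon>} \<and> \<theta> \<notin> {pi - \<epsilon> .. pi + \<epsilon>} \<and> \<theta> \<notin> {3*pi/2 - \<epsilon> .. 3*pi/2 + \<epsilon>}
        \<longrightarrow> v3 \<theta> > max 1 (2 * \<beta>) * (4 / (1 - \<epsilon>)^2) * (sqrt 2 + 1/2)^2)"

end

(*
  Particles at bond length 1 - epsilon or less, or carrying an angle far from all multiples of pi/2,
  can be removed with an energy gain, so by induction on N only configurations with nearly right
  angles matter. There each particle lies on two nearly perpendicular chains of nearly straight bonds
  ("strata"). The directions of bonds are sorted into sectors of opening angle pi/5, and a stratum is
  cut where it passes from one sector to another; averaging over the position of the sectors, the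
  cuts are paid for by the linear growth of v3 near pi. After cutting, the number of bonds is at most
  2 N - n with n the number of strata. Strata are the vertices and particles the edges of
  a graph: it is simple because a stratum moves within a cone, triangle-free because three sectors
  modulo 5 cannot be pairwise nearly perpendicular, and the b strata attached to the substrate form
  an independent set. If h is the size of a largest independent set of unattached strata, then
  N <= h (n - h) and b <= n - h, whence n - beta b >= m_beta(N) / 2. Equality forces unit bonds,
  exact angles and b = n - h; then every particle lies on an attached stratum, hence on the lattice.
*)
theory Submission
  imports Defs
begin

section \<open>Triangle-free graphs with an independent set\<close>

text \<open>The obstacle is that nearly right angles are local information: small bends add up along
  a chain, which might close up or meet another chain twice. Confining each stratum to one sector, a
  convex cone, excludes this. A fixed system of sectors, however, charges a fixed price for an
  arbitrarily small bend across a boundary; only the average over offsets makes the price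
  proportional to the bend. Constants: a bend d straddles a boundary with frequency 5 d / pi, and
  averaging over finitely many offsets loses a factor 2. The resulting 10 d / pi is a quarter of the
  bound 4 d / (pi/10) that (iii_3) puts below \<open>v3\<close>. So cuts cost a quarter of the sum
  of \<open>v3\<close> over ordered triples, while the energy contains half of it; the quarter left
  over forces exact angles in the case of equality. Five unoriented sectors work because a right
  angle spans two and a half of them. The removal induction closes because -2N + m_beta/2 does not
  increase with N, so a removal only has to lower the energy strictly.\<close>

text \<open>Let \<open>A\<close> be a largest independent set in \<open>V - B\<close>. Every edge is
  seen from some vertex outside \<open>A\<close> as an edge to a neighbour outside \<open>B\<close>,
  and such neighbours of one vertex form an independent set because there are no triangles, so there
  are at most \<open>h\<close> of them. If \<open>h + card B = card V\<close>, then \<open>A\<close>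
  is all of \<open>V - B\<close>, and an edge missing \<open>B\<close> would lie inside
  \<open>A\<close>.\<close>

lemma triangle_free_edge_bound:
  fixes V :: "'a set" and Ed :: "'a set set"
  assumes fin: "finite V" and BV: "B \<subseteq> V" and ne: "Ed \<noteq> {}"
    and ed: "\<And>e. e \<in> Ed \<Longrightarrow> \<exists>u v. u \<in> V \<and> v \<in> V \<and> u \<noteq> v \<and> e = {u, v}"
    and ind: "\<And>u v. u \<in> B \<Longrightarrow> v \<in> B \<Longrightarrow> {u, v} \<notin> Ed"
    and tri: "\<And>u v w. {u, v} \<in> Ed \<Longrightarrow> {v, w} \<in> Ed \<Longrightarrow> {u, w} \<in> Ed \<Longrightarrow> False"
  obtains h where "1 \<le> h" "h + card B \<le> card V" "card Ed \<le> h * (card V - h)"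
    "h + card B = card V \<longrightarrow> (\<forall>e\<in>Ed. e \<inter> B \<noteq> {})"
proof -
  define indep where "indep X \<longleftrightarrow> X \<subseteq> V - B \<and> (\<forall>u\<in>X. \<forall>v\<in>X. {u, v} \<notin> Ed)" for X
  have loopless: "{u, u} \<notin> Ed" for u
    using tri[of u u u] by blast
  have finI: "finite {X. indep X}"
    by (rule finite_subset[of _ "Pow V"]) (auto simp: indep_def fin)
  have neI: "{X. indep X} \<noteq> {}"
    by (auto simp: indep_def intro!: exI[of _ "{}"])
  define h where "h = Max (card ` {X. indep X})"
  have "h \<in> card ` {X. indep X}"
    unfolding h_def using finI neI by (intro Max_in) auto
  then obtain A where A: "indep A" "card A = h" by auto
  have le_h: "card X \<le> h" if "indep X" for X
    unfolding h_def using finI that by (intro Max_ge) auto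
  have finA: "finite A" and AV: "A \<subseteq> V - B" using A fin by (auto simp: indep_def intro: finite_subset)
  define D where "D v = {u \<in> V - B. {v, u} \<in> Ed}" for v
  have D_le: "card (D v) \<le> h" for v
  proof (rule le_h, unfold indep_def, intro conjI ballI)
    show "D v \<subseteq> V - B" by (auto simp: D_def)
    show "{a, b} \<notin> Ed" if "a \<in> D v" "b \<in> D v" for a b
      using that tri[of v a b] by (auto simp: D_def)
  qed
  have finD: "finite (D v)" for v using fin by (auto simp: D_def)
  have "Ed \<subseteq> (\<Union>v\<in>V - A. (\<lambda>u. {v, u}) ` D v)"
  proof
    fix e assume "e \<in> Ed"
    from ed[OF this] obtain u v where uv: "u \<in> V" "v \<in> V" "u \<noteq> v" "e = {u, v}" by blast
    \<comment> \<open>If the edge meets \<open>B\<close>, then \<open>v\<close> is its end in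
      \<open>B\<close>, which is disjoint from \<open>A\<close>, and independence of
      \<open>B\<close> puts the other end outside \<open>B\<close>. Otherwise \<open>v\<close> is an
      end outside \<open>A\<close>.\<close>
    have "\<exists>v u. v \<in> V - A \<and> u \<in> V - B \<and> e = {v, u}"
    proof (cases "u \<in> B \<or> v \<in> B")
      case True
      then show ?thesis using uv ind[of u v] \<open>e \<in> Ed\<close> AV by (blast intro: insert_commute)
    next
      case False
      then have "u \<notin> A \<or> v \<notin> A" using A(1) \<open>e \<in> Ed\<close> uv by (auto simp: indep_def)
      then show ?thesis using uv False by (blast intro: insert_commute)
    qed
    then show "e \<in> (\<Union>v\<in>V - A. (\<lambda>u. {v, u}) ` D v)"
      using \<open>e \<in> Ed\<close> by (fastforce simp: D_def)
  qed
  then have "card Ed \<le> card (\<Union>v\<in>V - A. (\<lambda>u. {v, u}) ` D v)"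
    using fin finD by (intro card_mono) auto
  also have "\<dots> \<le> (\<Sum>v\<in>V - A. card ((\<lambda>u. {v, u}) ` D v))"
    using fin by (intro card_UN_le) auto
  also have "\<dots> \<le> (\<Sum>v\<in>V - A. h)"
    by (intro sum_mono order_trans[OF card_image_le[OF finD] D_le])
  also have "\<dots> = h * (card V - h)"
    using AV A(2) finA by (simp add: card_Diff_subset le_infI1 Diff_subset subset_trans[OF AV])
  finally have N: "card Ed \<le> h * (card V - h)" .
  moreover from ne have "card Ed \<noteq> 0"
    using fin ed by (subst card_0_eq) (auto intro!: finite_subset[of Ed "Pow V"])
  ultimately have h1: "1 \<le> h" by (cases h) auto
  have cardVB: "card (V - B) = card V - card B" and "card B \<le> card V"
    using BV fin by (auto intro: card_Diff_subset card_mono finite_subset)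
  moreover have "h \<le> card (V - B)" using A(2) AV fin card_mono[of "V - B" A] by auto
  ultimately have hb: "h + card B \<le> card V" by auto
  have "\<forall>e\<in>Ed. e \<inter> B \<noteq> {}" if "h + card B = card V"
  proof -
    have "A = V - B" using that cardVB A(2) AV fin by (intro card_subset_eq) auto
    then show ?thesis using ed A(1) unfolding indep_def by fastforce
  qed
  with h1 hb N that show thesis by blast
qed

section \<open>The minimal value\<close>

lemma m_beta_le: "h \<in> {1..N} \<Longrightarrow> m_beta \<beta> N \<le> mval \<beta> N h"
  unfolding m_beta_def by (intro Min_le) auto

lemma m_beta_attained:
  assumes "N \<ge> 1" obtains h where "h \<in> {1..N}" "mval \<beta> N h = m_beta \<beta> N"
proof -
  have "m_beta \<beta> N \<in> mval \<beta> N ` {1..N}"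
    unfolding m_beta_def using assms by (intro Min_in) auto
  with that show thesis by auto
qed

lemma nat_ceiling_div_mono_Suc:
  assumes "h \<ge> 1"
  shows "real (nat \<lceil>real (Suc N) / real h\<rceil>) \<le> real (nat \<lceil>real N / real h\<rceil>) + 1"
    "real (nat \<lceil>real N / real h\<rceil>) \<le> real (nat \<lceil>real (Suc N) / real h\<rceil>)"
proof -
  have "real (Suc N) / real h \<le> real N / real h + 1"
    using assms by (simp add: field_simps)
  then have "\<lceil>real (Suc N) / real h\<rceil> \<le> \<lceil>real N / real h + 1\<rceil>" by (rule ceiling_mono)
  moreover have "0 \<le> real N / real h" by simp
  then have "0 \<le> \<lceil>real N / real h\<rceil>" by linarith
  ultimately have "nat \<lceil>real (Suc N) / real h\<rceil> \<le> nat \<lceil>real N / real h\<rceil> + 1"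
    by (simp add: nat_le_iff)
  then show "real (nat \<lceil>real (Suc N) / real h\<rceil>) \<le> real (nat \<lceil>real N / real h\<rceil>) + 1"
    by linarith
  have "real N / real h \<le> real (Suc N) / real h" by (simp add: divide_right_mono)
  then show "real (nat \<lceil>real N / real h\<rceil>) \<le> real (nat \<lceil>real (Suc N) / real h\<rceil>)"
    by (intro of_nat_mono nat_mono ceiling_mono)
qed

text \<open>A minimiser for \<open>N\<close> is still a competitor for \<open>Suc N\<close>, and its
  ceiling rises by at most 1. The slack 4 is exactly what keeps
  \<open>- 2 * N + m_beta \<beta> N / 2\<close> from increasing with \<open>N\<close>.\<close>

lemma m_beta_Suc_le:
  assumes "\<beta> > 0" "N \<ge> 1"
  shows "m_beta \<beta> (Suc N) \<le> m_beta \<beta> N + 4"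
proof -
  obtain h where h: "h \<in> {1..N}" "mval \<beta> N h = m_beta \<beta> N"
    using m_beta_attained assms(2) by blast
  have "m_beta \<beta> (Suc N) \<le> mval \<beta> (Suc N) h" using h by (intro m_beta_le) auto
  also have "\<dots> \<le> mval \<beta> N h + 4"
  proof -
    define d where "d = real (nat \<lceil>real (Suc N) / real h\<rceil>) - real (nat \<lceil>real N / real h\<rceil>)"
    have "0 \<le> d" "d \<le> 1" using nat_ceiling_div_mono_Suc[of h N] h by (auto simp: d_def)
    then have "(1 - \<beta>) * d \<le> 1 * 1" using assms
      by (metis (no_types, opaque_lifting) diff_gt_0_iff_gt diff_le_eq le_add_same_cancel1 less_imp_le mult.commute mult_left_le mult_mono zero_le_one)
    then show ?thesis unfolding mval_def d_def by (simp add: algebra_simps)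
  qed
  finally show ?thesis using h by simp
qed

lemma m_beta_1: "m_beta \<beta> 1 = 2 + 2 * (1 - \<beta>)"
  by (simp add: m_beta_def mval_def)

text \<open>For \<beta> > 1 the factor 1 - \<beta> is negative, so a large ceiling is favourable and
  \<open>h = 1\<close> is best in both terms, strictly in the first.\<close>

lemma m_beta_gt_1:
  assumes "\<beta> > 1" "N \<ge> 1"
  shows "m_beta \<beta> N = 2 + 2 * (1 - \<beta>) * real N" "h_star \<beta> N = 1"
proof -
  have ge: "mval \<beta> N h \<ge> 2 * real h + 2 * (1 - \<beta>) * real N" if "h \<in> {1..N}" for h
  proof -
    have "real N / real h \<le> real N" using that by (auto simp: field_simps)
    then have "nat \<lceil>real N / real h\<rceil> \<le> N" by (subst nat_le_iff, subst ceiling_le_iff) simp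
    then have "(1 - \<beta>) * real N \<le> (1 - \<beta>) * real (nat \<lceil>real N / real h\<rceil>)"
      by (rule mult_left_mono_neg[OF of_nat_mono]) (use assms(1) in simp)
    then show ?thesis unfolding mval_def mult.assoc by linarith
  qed
  have e1: "mval \<beta> N 1 = 2 + 2 * (1 - \<beta>) * real N" by (simp add: mval_def)
  show m: "m_beta \<beta> N = 2 + 2 * (1 - \<beta>) * real N"
  proof (rule antisym)
    show "m_beta \<beta> N \<le> 2 + 2 * (1 - \<beta>) * real N" using m_beta_le[of 1 N \<beta>] assms e1 by simp
    obtain h where h: "h \<in> {1..N}" "mval \<beta> N h = m_beta \<beta> N"
      using m_beta_attained assms(2) by blast
    have "1 \<le> real h" using h(1) by simp
    then show "2 + 2 * (1 - \<beta>) * real N \<le> m_beta \<beta> N" using ge[OF h(1)] h(2) by linarith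
  qed
  have "{h \<in> {1..N}. mval \<beta> N h = m_beta \<beta> N} = {1}"
  proof -
    have "h = 1" if "h \<in> {1..N}" "mval \<beta> N h = m_beta \<beta> N" for h
    proof -
      have "real h \<le> 1" using ge[OF that(1)] that(2) m by linarith
      then show ?thesis using that(1) by simp
    qed
    then show ?thesis using assms m e1 by auto
  qed
  then show "h_star \<beta> N = 1" by (simp add: h_star_def)
qed

text \<open>With \<open>w = n - h\<close> the right side is at least h + (1 - \<beta>) w. For
  \<beta> at most 1 this is compared with \<open>mval\<close> at \<open>h\<close>, using that
  \<open>w\<close> is at least the ceiling of N/h. For \<beta> > 1 the sign of the coefficient is
  wrong; there \<open>b \<le> N\<close> and the explicit minimum at \<open>h = 1\<close> replace it.
  Equality gives \<open>b = w\<close>; for \<beta> at most 1 it also makes \<open>h\<close> a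
  minimiser, so \<open>h \<le> h_star \<beta> N\<close>.\<close>

lemma m_beta_lower_bound:
  fixes \<beta> :: real and N h n b :: nat
  assumes "\<beta> > 0" "N \<ge> 1" "1 \<le> h" "h + b \<le> n" "N \<le> h * (n - h)" "b \<le> N"
  shows "m_beta \<beta> N / 2 \<le> real n - \<beta> * real b"
    and "m_beta \<beta> N / 2 = real n - \<beta> * real b \<Longrightarrow>
      h + b = n \<and> real N / real (h_star \<beta> N) \<le> real b"
proof -
  define w where "w = n - h"
  have n: "real n = real h + real w" and bw: "b \<le> w" and Nhw: "N \<le> h * w"
    using assms by (auto simp: w_def)
  have main: "m_beta \<beta> N / 2 \<le> real n - \<beta> * real b \<and>
    (m_beta \<beta> N / 2 = real n - \<beta> * real b \<longrightarrow> h + b = n \<and> real N / real (h_star \<beta> N) \<le> real b)"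
  proof (cases "\<beta> > 1")
    case True
    have m: "m_beta \<beta> N / 2 = 1 + (1 - \<beta>) * real N" "h_star \<beta> N = 1"
      using m_beta_gt_1[OF True assms(2)] by auto
    have 1: "(1 - \<beta>) * real N \<le> (1 - \<beta>) * real b"
      using True assms(6) by (intro mult_left_mono_neg) auto
    have hr: "real h \<ge> 1" "real w \<ge> real b" using assms bw by auto
    have ident: "real n - \<beta> * real b = real h + (real w - real b) + (1 - \<beta>) * real b"
      using n by (simp add: algebra_simps)
    have "h + b = n \<and> real N / real (h_star \<beta> N) \<le> real b"
      if "m_beta \<beta> N / 2 = real n - \<beta> * real b"
    proof -
      have eqs: "(1 - \<beta>) * real N = (1 - \<beta>) * real b" "real w = real b"
        using 1 hr ident that m by linarith+
      then have "real N = real b" using True by simp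
      moreover have "h + b = n" using eqs(2) n by linarith
      ultimately show ?thesis using m by simp
    qed
    moreover have "m_beta \<beta> N / 2 \<le> real n - \<beta> * real b" using 1 hr ident m by linarith
    ultimately show ?thesis by blast
  next
    case False
    have bb: "\<beta> * real b \<le> \<beta> * real w" using bw assms(1) by simp
    have id: "real n - \<beta> * real w = real h + (1 - \<beta>) * real w" using n by (simp add: algebra_simps)
    show ?thesis
    proof (cases "h \<le> N")
      case True
      have "real N / real h \<le> real w" using Nhw assms(3)
        by (simp add: field_simps flip: of_nat_mult)
      then have "nat \<lceil>real N / real h\<rceil> \<le> w" by (subst nat_le_iff, subst ceiling_le_iff) simp
      then have "(1 - \<beta>) * real (nat \<lceil>real N / real h\<rceil>) \<le> (1 - \<beta>) * real w"
        by (rule mult_left_mono[OF of_nat_mono]) (use False in simp)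
      moreover have "mval \<beta> N h / 2 = real h + (1 - \<beta>) * real (nat \<lceil>real N / real h\<rceil>)"
        by (simp add: mval_def field_simps)
      ultimately have m1: "mval \<beta> N h / 2 \<le> real n - \<beta> * real w" unfolding id by linarith
      have m0: "m_beta \<beta> N \<le> mval \<beta> N h" using True assms(3) by (intro m_beta_le) auto
      have "h + b = n \<and> real N / real (h_star \<beta> N) \<le> real b"
        if "m_beta \<beta> N / 2 = real n - \<beta> * real b"
      proof -
        have "\<beta> * real b = \<beta> * real w" and mv: "mval \<beta> N h = m_beta \<beta> N"
          using that m0 m1 bb by linarith+
        then have bw': "b = w" using assms(1) by simp
        have "h \<le> h_star \<beta> N" unfolding h_star_def using mv True assms(3) by (intro Max_ge) auto
        then have "N \<le> h_star \<beta> N * b" using Nhw bw' by (meson le_trans mult_le_mono1)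
        moreover have "h_star \<beta> N > 0" using \<open>h \<le> h_star \<beta> N\<close> assms(3) by linarith
        ultimately have "real N / real (h_star \<beta> N) \<le> real b"
          by (simp add: field_simps flip: of_nat_mult)
        moreover have "h + b = n" using bw' w_def assms(4) by linarith
        ultimately show ?thesis by blast
      qed
      moreover have "m_beta \<beta> N / 2 \<le> real n - \<beta> * real b" using m0 m1 bb by linarith
      ultimately show ?thesis by blast
    next
      \<comment> \<open>Here \<open>h\<close> lies outside the range of the minimum. The competitor
        is \<open>N\<close> itself, with ceiling 1, and the inequality is strict.\<close>
      case hN: False
      have "m_beta \<beta> N \<le> mval \<beta> N N" using assms(2) by (intro m_beta_le) auto
      also have "mval \<beta> N N = 2 * real N + 2 * (1 - \<beta>)" using assms(2) by (simp add: mval_def)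
      finally have m0: "m_beta \<beta> N / 2 \<le> real N + (1 - \<beta>)" by simp
      have "w \<noteq> 0"
      proof
        assume "w = 0"
        then show False using Nhw assms(2) by simp
      qed
      then have "(1 - \<beta>) * 1 \<le> (1 - \<beta>) * real w" using False by (intro mult_left_mono) auto
      moreover have "real h \<ge> real N + 1" using hN by simp
      ultimately have "real N + 1 + (1 - \<beta>) \<le> real n - \<beta> * real w" using id by simp
      then have "m_beta \<beta> N / 2 < real n - \<beta> * real b" using m0 bb by linarith
      then show ?thesis by auto
    qed
  qed
  from main show "m_beta \<beta> N / 2 \<le> real n - \<beta> * real b" by blast
  from main show "h + b = n \<and> real N / real (h_star \<beta> N) \<le> real b"
    if "m_beta \<beta> N / 2 = real n - \<beta> * real b" using that by blast
qed

section \<open>A good offset by averaging\<close>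

text \<open>An offset that separates \<open>a\<close> from \<open>b\<close> puts a point of the
  shifted integer grid into the interval (a, b]. Multiplied by \<open>K\<close>, this point is the
  integer \<open>g j\<close> in (K a, K b], and \<open>j\<close> is its residue modulo
  \<open>K\<close>, so different offsets give different integers.\<close>

lemma card_offsets_le:
  fixes a b :: real and K :: nat
  assumes "a \<le> b" "K > 0"
  shows "real (card {j \<in> {..<K}. \<lfloor>a - real j / real K\<rfloor> \<noteq> \<lfloor>b - real j / real K\<rfloor>}) \<le> real K * (b - a) + 1"
proof -
  define J where "J = {j \<in> {..<K}. \<lfloor>a - real j / real K\<rfloor> \<noteq> \<lfloor>b - real j / real K\<rfloor>}"
  define g where "g j = int K * \<lfloor>b - real j / real K\<rfloor> + int j" for j
  have inj: "inj_on g J"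
  proof (rule inj_onI)
    fix i j assume ij: "i \<in> J" "j \<in> J" "g i = g j"
    have "g i mod int K = int i" "g j mod int K = int j" using ij(1,2) by (auto simp: g_def J_def)
    with ij(3) have "int i = int j" by metis
    then show "i = j" by simp
  qed
  have "g ` J \<subseteq> {\<lfloor>real K * a\<rfloor><..\<lfloor>real K * b\<rfloor>}"
  proof
    fix m assume "m \<in> g ` J"
    then obtain j where j: "j \<in> J" "m = g j" by auto
    define f where "f = \<lfloor>b - real j / real K\<rfloor>"
    have "\<lfloor>a - real j / real K\<rfloor> \<le> f" unfolding f_def using assms by (intro floor_mono) auto
    with j(1) have "\<lfloor>a - real j / real K\<rfloor> < f" by (auto simp: J_def f_def)
    then have "a - real j / real K < of_int f" by (simp add: floor_less_iff)
    moreover have "of_int f \<le> b - real j / real K" by (simp add: f_def)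
    ultimately have "real K * a < real K * of_int f + real j" "real K * of_int f + real j \<le> real K * b"
      using assms(2) by (simp_all add: field_simps)
    moreover have "real_of_int m = real K * of_int f + real j" by (simp add: j(2) g_def f_def)
    ultimately show "m \<in> {\<lfloor>real K * a\<rfloor><..\<lfloor>real K * b\<rfloor>}"
      by (auto simp: floor_less_iff le_floor_iff)
  qed
  then have "card (g ` J) \<le> card {\<lfloor>real K * a\<rfloor><..\<lfloor>real K * b\<rfloor>}" by (intro card_mono) auto
  then have "real (card J) \<le> real (nat (\<lfloor>real K * b\<rfloor> - \<lfloor>real K * a\<rfloor>))"
    using inj by (simp add: card_image)
  also have "\<dots> = real_of_int (\<lfloor>real K * b\<rfloor> - \<lfloor>real K * a\<rfloor>)"
    by (rule of_nat_nat) (use assms in \<open>auto intro!: floor_mono mult_left_mono\<close>)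
  also have "\<dots> \<le> real K * b - real K * a + 1" by linarith
  finally show ?thesis by (simp add: J_def algebra_simps)
qed

text \<open>An average over the offsets j/K: the index i is separated by at most K |a i - b i| + 1
  of the K offsets, and an offset no worse than the average does.\<close>

lemma exists_offset:
  fixes a b :: "'i \<Rightarrow> real"
  assumes fin: "finite I"
  obtains t where "real (card {i \<in> I. \<lfloor>a i - t\<rfloor> \<noteq> \<lfloor>b i - t\<rfloor>}) \<le> 2 * (\<Sum>i\<in>I. \<bar>a i - b i\<bar>)"
proof -
  \<comment> \<open>\<open>g\<close> is at most every nonzero gap. Taking \<open>K\<close> above 1/g
    lets K |a i - b i| absorb the rounding term 1, which is the origin of the factor 2. The element
    1 keeps the set nonempty.\<close>
  define gaps where "gaps = insert 1 ((\<lambda>i. \<bar>a i - b i\<bar>) ` I - {0})"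
  define g where "g = Min gaps"
  have gp: "g > 0" unfolding g_def gaps_def using fin by (subst Min_gr_iff) auto
  have g_le: "g \<le> \<bar>a i - b i\<bar>" if "i \<in> I" "a i \<noteq> b i" for i
    unfolding g_def gaps_def using fin that by (intro Min_le) auto
  obtain K :: nat where K: "1 / g < real K" using reals_Archimedean2 by blast
  with gp have K0: "K > 0" by (cases K) (auto simp: field_simps)
  have Kg: "1 \<le> real K * g" using K gp by (simp add: field_simps)
  define P where "P i j \<longleftrightarrow> \<lfloor>a i - real j / real K\<rfloor> \<noteq> \<lfloor>b i - real j / real K\<rfloor>" for i and j :: nat
  have each: "real (card {j \<in> {..<K}. P i j}) \<le> 2 * real K * \<bar>a i - b i\<bar>" if "i \<in> I" for i
  proof (cases "a i = b i")
    case True then show ?thesis by (simp add: P_def)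
  next
    case False
    have "real (card {j \<in> {..<K}. P i j}) \<le> real K * \<bar>a i - b i\<bar> + 1"
    proof (cases "a i \<le> b i")
      case True
      then show ?thesis using card_offsets_le[OF True K0] by (simp add: P_def)
    next
      case False
      then have "b i \<le> a i" by simp
      then show ?thesis using card_offsets_le[OF _ K0, of "b i" "a i"] by (simp add: P_def neq_commute)
    qed
    moreover have "1 \<le> real K * \<bar>a i - b i\<bar>"
      using Kg mult_left_mono[OF g_le[OF that False], of "real K"] by linarith
    ultimately show ?thesis by linarith
  qed
  define M where "M = 2 * (\<Sum>i\<in>I. \<bar>a i - b i\<bar>)"
  have "\<exists>j\<in>{..<K}. real (card {i \<in> I. P i j}) \<le> M"
  proof (rule ccontr)
    assume "\<not> ?thesis"
    then have gt: "\<And>j. j \<in> {..<K} \<Longrightarrow> M < real (card {i \<in> I. P i j})" by force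
    have "real K * M = (\<Sum>j<K. M)" by simp
    also have "\<dots> < (\<Sum>j<K. real (card {i \<in> I. P i j}))" using K0 gt by (intro sum_strict_mono) auto
    also have "\<dots> = (\<Sum>j<K. \<Sum>i\<in>I. if P i j then 1 else 0)"
      using fin by (intro sum.cong) (auto simp: sum.If_cases Int_def)
    also have "\<dots> = (\<Sum>i\<in>I. \<Sum>j<K. if P i j then 1 else 0)" by (rule sum.swap)
    also have "\<dots> = (\<Sum>i\<in>I. real (card {j \<in> {..<K}. P i j}))"
      by (intro sum.cong) (auto simp: sum.If_cases Int_def)
    also have "\<dots> \<le> (\<Sum>i\<in>I. 2 * real K * \<bar>a i - b i\<bar>)" using each by (intro sum_mono)
    also have "\<dots> = real K * M" by (simp add: M_def sum_distrib_left mult_ac)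
    finally show False by simp
  qed
  then show thesis using that unfolding M_def P_def by blast
qed

section \<open>Directions\<close>

lemma Arg_rcis_cong:
  assumes "r > 0" obtains m :: int where "Arg (rcis r a) = a + 2 * pi * of_int m"
proof -
  have nz: "rcis r a \<noteq> 0" using assms by simp
  have "sin (Arg (rcis r a)) = sin a" "cos (Arg (rcis r a)) = cos a"
    using assms by (simp_all add: sin_Arg[OF nz] cos_Arg[OF nz])
  then show thesis using that sin_cos_eq_iff by blast
qed

text \<open>Sectors of opening angle \<^term>\<open>pi / 5\<close>: three strata crossing pairwise at nearly right angles
  would give three sector indices modulo 5 that pairwise differ by 2 or 3, which is impossible.\<close>

definition dsec :: "real \<Rightarrow> complex \<Rightarrow> int" where
  "dsec t u = \<lfloor>5 * Arg u / pi - t\<rfloor> mod 10"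

text \<open>Opposite directions have \<open>dsec\<close> indices 5 apart, so reduction modulo 5
  forgets the orientation of a bond.\<close>

definition sec :: "real \<Rightarrow> complex \<Rightarrow> int" where
  "sec t u = dsec t u mod 5"

lemma dsec_bounds: "0 \<le> dsec t u" "dsec t u < 10"
  by (simp_all add: dsec_def)

lemma sec_bounds: "0 \<le> sec t u" "sec t u < 5"
  by (simp_all add: sec_def)

lemma sec_eq: "sec t u = \<lfloor>5 * Arg u / pi - t\<rfloor> mod 5"
  by (simp add: sec_def dsec_def mod_mod_cancel)

lemma dsec_rcis:
  assumes "r > 0" shows "dsec t (rcis r a) = \<lfloor>5 * a / pi - t\<rfloor> mod 10"
proof -
  obtain m where "Arg (rcis r a) = a + 2 * pi * of_int m" using Arg_rcis_cong assms by blast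
  then have "5 * Arg (rcis r a) / pi - t = (5 * a / pi - t) + of_int (10 * m)"
    by (simp add: field_simps)
  then have "\<lfloor>5 * Arg (rcis r a) / pi - t\<rfloor> = \<lfloor>5 * a / pi - t\<rfloor> + 10 * m"
    by (simp only: floor_add_int)
  then show ?thesis by (simp add: dsec_def)
qed

lemma dsec_uminus:
  assumes "u \<noteq> 0" shows "dsec t (- u) = (dsec t u + 5) mod 10"
proof -
  have "- u = rcis (cmod u) (Arg u + pi)"
  proof -
    have "u = rcis (cmod u) (Arg u)" by (simp add: rcis_cmod_Arg)
    then show ?thesis by (metis cis_mult cis_pi mult.assoc mult_minus1_right rcis_def)
  qed
  then have "dsec t (- u) = \<lfloor>5 * (Arg u + pi) / pi - t\<rfloor> mod 10"
    using dsec_rcis[of "cmod u" t "Arg u + pi"] assms by simp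
  moreover have "5 * (Arg u + pi) / pi - t = (5 * Arg u / pi - t) + of_int 5"
    by (simp add: field_simps)
  then have "\<lfloor>5 * (Arg u + pi) / pi - t\<rfloor> = \<lfloor>5 * Arg u / pi - t\<rfloor> + 5"
    by (simp only: floor_add_int)
  ultimately show ?thesis by (simp add: dsec_def mod_simps)
qed

lemma sec_uminus: "u \<noteq> 0 \<Longrightarrow> sec t (- u) = sec t u"
  unfolding sec_def by (simp add: dsec_uminus mod_mod_cancel)

text \<open>A sector is a convex cone. After rotation by -a the sum is \<open>w\<close>, and the
  signs of \<open>Im w\<close> and of sin (Arg w - d) place \<open>Arg w\<close> between 0 and
  \<open>d\<close>; the narrow sector gives d < pi/2 and hence \<open>Re w > 0\<close>.\<close>

lemma dsec_add_aux:
  assumes "r > 0" "s > 0" "a \<le> b" "\<lfloor>5 * a / pi - t\<rfloor> = \<lfloor>5 * b / pi - t\<rfloor>"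
  shows "rcis r a + rcis s b \<noteq> 0 \<and> dsec t (rcis r a + rcis s b) = \<lfloor>5 * a / pi - t\<rfloor> mod 10"
proof -
  define d where "d = b - a"
  have "5 * b / pi - t < 5 * a / pi - t + 1" using assms(4) by linarith
  then have "5 * d < pi" by (simp add: d_def field_simps)
  then have d: "0 \<le> d" "d < pi / 2" using assms(3) pi_gt_zero by (auto simp: d_def)
  define w where "w = complex_of_real r + rcis s d"
  have cd: "cos d > 0" using d by (intro cos_gt_zero_pi) auto
  have sd: "sin d \<ge> 0" using d pi_gt_zero by (intro sin_ge_zero) auto
  have Re_w: "Re w = r + s * cos d" and Im_w: "Im w = s * sin d" by (simp_all add: w_def)
  have Re_pos: "Re w > 0" using assms cd by (simp add: Re_w add_pos_pos)
  then have w0: "w \<noteq> 0" by auto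
  have A0: "0 \<le> Arg w" using Im_w sd assms by (simp add: Arg_less_0)
  have A2: "Arg w < pi / 2" using Re_pos Arg_Re_pos[of w] by auto
  have Ad: "Arg w \<le> d"
  proof (rule ccontr)
    assume "\<not> Arg w \<le> d"
    then have "0 < sin (Arg w - d)" using d A2 A0 pi_gt_zero by (intro sin_gt_zero) linarith+
    also have "sin (Arg w - d) = (Im w * cos d - Re w * sin d) / cmod w"
      by (simp add: sin_diff sin_Arg[OF w0] cos_Arg[OF w0] diff_divide_distrib)
    finally have "0 < Im w * cos d - Re w * sin d" using w0 by (simp add: zero_less_divide_iff)
    also have "\<dots> = - r * sin d" by (simp add: Re_w Im_w algebra_simps)
    finally show False using sd assms(1) by (simp add: mult_less_0_iff)
  qed
  have "rcis r a + rcis s b = w * cis a"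
    by (simp add: w_def d_def rcis_def algebra_simps cis_mult)
  also have "\<dots> = rcis (cmod w) (Arg w) * cis a" by (simp add: rcis_cmod_Arg)
  also have "\<dots> = rcis (cmod w) (a + Arg w)" by (simp add: rcis_def cis_mult add.commute)
  finally have eq: "rcis r a + rcis s b = rcis (cmod w) (a + Arg w)" .
  have "\<lfloor>5 * (a + Arg w) / pi - t\<rfloor> = \<lfloor>5 * a / pi - t\<rfloor>"
  proof (rule antisym)
    have "5 * (a + Arg w) / pi \<le> 5 * b / pi" using Ad by (simp add: d_def divide_right_mono)
    then show "\<lfloor>5 * (a + Arg w) / pi - t\<rfloor> \<le> \<lfloor>5 * a / pi - t\<rfloor>"
      unfolding assms(4) by (intro floor_mono) simp
    have "5 * a / pi \<le> 5 * (a + Arg w) / pi" using A0 by (simp add: divide_right_mono)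
    then show "\<lfloor>5 * a / pi - t\<rfloor> \<le> \<lfloor>5 * (a + Arg w) / pi - t\<rfloor>" by (intro floor_mono) simp
  qed
  then show ?thesis unfolding eq using w0 by (simp add: dsec_rcis)
qed

lemma dsec_add:
  assumes "u \<noteq> 0" "v \<noteq> 0" "dsec t u = dsec t v"
  shows "u + v \<noteq> 0" "dsec t (u + v) = dsec t u"
proof -
  define k where "k = dsec t u"
  \<comment> \<open>Equal \<open>dsec\<close> only means equal floors modulo 10. Shifting each
    argument by a multiple of 2 pi makes the floors themselves equal to \<open>k\<close>, as
    \<open>dsec_add_aux\<close> requires.\<close>
  have ex: "\<exists>r a. r > 0 \<and> z = rcis r a \<and> \<lfloor>5 * a / pi - t\<rfloor> = k" if "z \<noteq> 0" "dsec t z = k" for z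
  proof -
    define m where "m = \<lfloor>5 * Arg z / pi - t\<rfloor> div 10"
    define a where "a = Arg z - 2 * pi * of_int m"
    have "5 * a / pi - t = (5 * Arg z / pi - t) - of_int (10 * m)"
      by (simp add: a_def field_simps)
    then have "\<lfloor>5 * a / pi - t\<rfloor> = \<lfloor>5 * Arg z / pi - t\<rfloor> - 10 * m"
      by (simp only: floor_diff_of_int)
    also have "\<dots> = k" using that by (simp add: m_def dsec_def minus_mult_div_eq_mod)
    finally have "\<lfloor>5 * a / pi - t\<rfloor> = k" .
    moreover have "z = rcis (cmod z) a"
      by (metis rcis_cmod_Arg a_def rcis_def cis_multiple_2pi Ints_of_int cis_divide div_by_1)
    ultimately show ?thesis using that by (intro exI[of _ "cmod z"] exI[of _ a]) auto
  qed
  obtain r a where ra: "r > 0" "u = rcis r a" "\<lfloor>5 * a / pi - t\<rfloor> = k" using ex[of u] assms k_def by auto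
  obtain s b where sb: "s > 0" "v = rcis s b" "\<lfloor>5 * b / pi - t\<rfloor> = k" using ex[of v] assms k_def by auto
  have k: "k mod 10 = k" by (simp add: k_def dsec_def)
  have "u + v \<noteq> 0 \<and> dsec t (u + v) = k"
  proof (cases "a \<le> b")
    case True
    then show ?thesis using dsec_add_aux[of r s a b t] ra sb k by simp
  next
    case False
    then show ?thesis using dsec_add_aux[of s r b a t] ra sb k by (simp add: add.commute)
  qed
  then show "u + v \<noteq> 0" "dsec t (u + v) = dsec t u" by (auto simp: k_def)
qed

section \<open>Angles\<close>

lemma theta_range: "0 \<le> theta x y z" "theta x y z < 2 * pi"
  using Arg_bounded[of "(x - y) / (z - y)"] pi_gt_zero by (auto simp: theta_def Let_def)

lemma theta_Arg:
  assumes "x \<noteq> y" "z \<noteq> y"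
  obtains m :: int where "Arg (x - y) = Arg (z - y) + theta x y z + 2 * pi * of_int m"
proof -
  define q where "q = (x - y) / (z - y)"
  have q0: "q \<noteq> 0" using assms by (simp add: q_def)
  have "x - y = (z - y) * q" using assms by (simp add: q_def)
  also have "\<dots> = rcis (cmod (z - y)) (Arg (z - y)) * rcis (cmod q) (Arg q)" by (simp add: rcis_cmod_Arg)
  also have "\<dots> = rcis (cmod (z - y) * cmod q) (Arg (z - y) + Arg q)" by (simp add: rcis_mult)
  finally obtain m :: int where m: "Arg (x - y) = Arg (z - y) + Arg q + 2 * pi * of_int m"
    using Arg_rcis_cong[of "cmod (z - y) * cmod q" "Arg (z - y) + Arg q"] assms q0 by auto
  show thesis
  proof (cases "Arg q < 0")
    case True
    then show thesis using m by (intro that[of "m - 1"]) (simp add: theta_def Let_def algebra_simps flip: q_def)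
  next
    case False
    then show thesis using m by (intro that[of m]) (simp add: theta_def Let_def flip: q_def)
  qed
qed

lemma theta_eqI:
  assumes "x \<noteq> y" "z \<noteq> y" "0 \<le> \<phi>" "\<phi> < 2 * pi" "Arg (x - y) = Arg (z - y) + \<phi> + 2 * pi * of_int m"
  shows "theta x y z = \<phi>"
proof -
  obtain m' where "Arg (x - y) = Arg (z - y) + theta x y z + 2 * pi * of_int m'"
    using theta_Arg assms by blast
  then have eq: "theta x y z - \<phi> = 2 * pi * of_int (m - m')" using assms(5) by (simp add: algebra_simps)
  moreover have "\<bar>theta x y z - \<phi>\<bar> < 2 * pi" using theta_range[of x y z] assms by auto
  ultimately have "\<bar>real_of_int (m - m')\<bar> < 1" by (simp add: abs_mult)
  then have "m - m' = 0" by linarith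
  then show ?thesis using eq by simp
qed

lemma theta_swap:
  assumes "x \<noteq> y" "z \<noteq> y"
  shows "theta z y x = (if theta x y z = 0 then 0 else 2 * pi - theta x y z)"
proof -
  obtain m where m: "Arg (x - y) = Arg (z - y) + theta x y z + 2 * pi * of_int m"
    using theta_Arg assms by blast
  show ?thesis
  proof (cases "theta x y z = 0")
    case True
    then show ?thesis using m assms by (intro theta_eqI[of _ _ _ _ "- m"]) auto
  next
    case False
    then show ?thesis using m assms theta_range[of x y z]
      by (intro theta_eqI[of _ _ _ _ "- m - 1"]) (auto simp: algebra_simps)
  qed
qed

definition right_angled :: "real \<Rightarrow> real \<Rightarrow> bool" where
  "right_angled \<epsilon> \<phi> \<longleftrightarrow> \<bar>\<phi> - pi / 2\<bar> \<le> \<epsilon> \<or> \<bar>\<phi> - pi\<bar> \<le> \<epsilon> \<or> \<bar>\<phi> - 3 * pi / 2\<bar> \<le> \<epsilon>"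

lemma right_angled_swap:
  assumes "x \<noteq> y" "z \<noteq> y" "0 < \<epsilon>" "\<epsilon> < 1 / 20" "right_angled \<epsilon> (theta x y z)"
  shows "right_angled \<epsilon> (theta z y x)"
  using assms(3-) pi_gt3 theta_swap[OF assms(1,2)] unfolding right_angled_def
  by (auto simp: abs_le_iff split: if_splits)

text \<open>Angles are measured in sectors: a right angle is 5/2, a straight angle 5, a full turn
  10. Adding \<open>p\<close> moves the floor by the floor or the ceiling of \<open>p\<close>, which
  leaves two values around a half-integer and three around an integer.\<close>

lemma floor_shift_mod10:
  fixes A B p :: real and m :: int
  assumes "A = B + p + 10 * of_int m"
  shows "\<bar>p - 5/2\<bar> \<le> 1/10 \<Longrightarrow> (\<lfloor>A\<rfloor> mod 10 - \<lfloor>B\<rfloor> mod 10) mod 10 \<in> {2, 3}"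
    and "\<bar>p - 5\<bar> \<le> 1/10 \<Longrightarrow> (\<lfloor>A\<rfloor> mod 10 - \<lfloor>B\<rfloor> mod 10) mod 10 \<in> {4, 5, 6}"
    and "\<bar>p - 15/2\<bar> \<le> 1/10 \<Longrightarrow> (\<lfloor>A\<rfloor> mod 10 - \<lfloor>B\<rfloor> mod 10) mod 10 \<in> {7, 8}"
proof -
  define d where "d = \<lfloor>B + p\<rfloor> - \<lfloor>B\<rfloor>"
  have "A = B + p + of_int (10 * m)" using assms by simp
  then have "\<lfloor>A\<rfloor> = \<lfloor>B + p\<rfloor> + 10 * m" by (simp only: floor_add_int)
  then have e: "(\<lfloor>A\<rfloor> mod 10 - \<lfloor>B\<rfloor> mod 10) mod 10 = d mod 10"
    by (simp add: d_def mod_simps)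
  show "\<bar>p - 5/2\<bar> \<le> 1/10 \<Longrightarrow> (\<lfloor>A\<rfloor> mod 10 - \<lfloor>B\<rfloor> mod 10) mod 10 \<in> {2, 3}"
  proof -
    assume "\<bar>p - 5/2\<bar> \<le> 1/10"
    then have "d = 2 \<or> d = 3" unfolding d_def by linarith
    then show ?thesis unfolding e by auto
  qed
  show "\<bar>p - 5\<bar> \<le> 1/10 \<Longrightarrow> (\<lfloor>A\<rfloor> mod 10 - \<lfloor>B\<rfloor> mod 10) mod 10 \<in> {4, 5, 6}"
  proof -
    assume "\<bar>p - 5\<bar> \<le> 1/10"
    then have "d = 4 \<or> d = 5 \<or> d = 6" unfolding d_def by linarith
    then show ?thesis unfolding e by auto
  qed
  show "\<bar>p - 15/2\<bar> \<le> 1/10 \<Longrightarrow> (\<lfloor>A\<rfloor> mod 10 - \<lfloor>B\<rfloor> mod 10) mod 10 \<in> {7, 8}"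
  proof -
    assume "\<bar>p - 15/2\<bar> \<le> 1/10"
    then have "d = 7 \<or> d = 8" unfolding d_def by linarith
    then show ?thesis unfolding e by auto
  qed
qed

lemma dsec_diff:
  assumes "x \<noteq> y" "z \<noteq> y" "\<epsilon> < 1 / 20"
  shows "\<bar>theta x y z - pi / 2\<bar> \<le> \<epsilon> \<Longrightarrow> (dsec t (x - y) - dsec t (z - y)) mod 10 \<in> {2, 3}"
    and "\<bar>theta x y z - pi\<bar> \<le> \<epsilon> \<Longrightarrow> (dsec t (x - y) - dsec t (z - y)) mod 10 \<in> {4, 5, 6}"
    and "\<bar>theta x y z - 3 * pi / 2\<bar> \<le> \<epsilon> \<Longrightarrow> (dsec t (x - y) - dsec t (z - y)) mod 10 \<in> {7, 8}"
proof -
  obtain m where m: "Arg (x - y) = Arg (z - y) + theta x y z + 2 * pi * of_int m"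
    using theta_Arg assms by blast
  define p where "p = 5 * theta x y z / pi"
  have A: "5 * Arg (x - y) / pi - t = (5 * Arg (z - y) / pi - t) + p + 10 * of_int m"
    by (simp add: m p_def field_simps)
  \<comment> \<open>This is where \<epsilon> < 1/20 enters: in units of sectors the tolerance is 5
    \<epsilon> / pi, which stays below 1/10.\<close>
  have *: "\<bar>p - 5 * c / pi\<bar> \<le> 1/10" if "\<bar>theta x y z - c\<bar> \<le> \<epsilon>" for c
  proof -
    have "p - 5 * c / pi = 5 * (theta x y z - c) / pi" by (simp add: p_def diff_divide_distrib right_diff_distrib)
    then have "\<bar>p - 5 * c / pi\<bar> = 5 * \<bar>theta x y z - c\<bar> / pi"
      by (simp only: abs_mult abs_divide) simp
    also have "\<dots> \<le> (1/4) / pi" using that assms(3) by (intro divide_right_mono) auto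
    also have "\<dots> \<le> 1/10" using pi_gt3 by (simp add: field_simps)
    finally show ?thesis .
  qed
  show "(dsec t (x - y) - dsec t (z - y)) mod 10 \<in> {2, 3}" if "\<bar>theta x y z - pi / 2\<bar> \<le> \<epsilon>"
    using floor_shift_mod10(1)[OF A] *[OF that] by (simp add: dsec_def)
  show "(dsec t (x - y) - dsec t (z - y)) mod 10 \<in> {4, 5, 6}" if "\<bar>theta x y z - pi\<bar> \<le> \<epsilon>"
    using floor_shift_mod10(2)[OF A] *[OF that] by (simp add: dsec_def)
  show "(dsec t (x - y) - dsec t (z - y)) mod 10 \<in> {7, 8}" if "\<bar>theta x y z - 3 * pi / 2\<bar> \<le> \<epsilon>"
    using floor_shift_mod10(3)[OF A] *[OF that] by (simp add: dsec_def)
qed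

section \<open>Neighbours and the real-valued energy\<close>

definition sub_nb :: "real \<Rightarrow> complex \<Rightarrow> complex set" where
  "sub_nb r0 x = {z \<in> substrate. cmod (x - z) < r0}"

definition nb :: "real \<Rightarrow> complex set \<Rightarrow> complex \<Rightarrow> complex set" where
  "nb r0 C x = {y \<in> C \<union> substrate. y \<noteq> x \<and> cmod (y - x) < r0}"

text \<open>Triples inside the substrate only carry angles that are multiples of \<^term>\<open>pi / 2\<close>, so these finitely many triples
  carry all of the three-body energy.\<close>

definition tri :: "real \<Rightarrow> complex set \<Rightarrow> (complex \<times> complex \<times> complex) set" where
  "tri r0 C = {(x, y, z). (x, y, z) \<in> triples r0 C \<and> (x \<in> C \<or> y \<in> C \<or> z \<in> C)}"

definition renergy :: "(real \<Rightarrow> real) \<Rightarrow> (real \<Rightarrow> real) \<Rightarrow> real \<Rightarrow> real \<Rightarrow> complex set \<Rightarrow> real" where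
  "renergy w v3 r0 \<beta> C =
     (\<Sum>x\<in>C. \<Sum>y\<in>C - {x}. w (cmod (x - y))) / 2
   + \<beta> * (\<Sum>x\<in>C. \<Sum>z\<in>sub_nb r0 x. w (cmod (x - z)))
   + (\<Sum>(x, y, z)\<in>tri r0 C. v3 (theta x y z)) / 2"

lemma finite_lattice_near: "finite {z \<in> lattice. cmod (x - z) < R}"
proof (rule finite_subset)
  let ?I = "\<lambda>a. {\<lfloor>a - R\<rfloor>..\<lceil>a + R\<rceil>}"
  show "{z \<in> lattice. cmod (x - z) < R} \<subseteq>
    (\<lambda>(a, b). Complex (of_int a) (of_int b)) ` (?I (Re x) \<times> ?I (Im x))"
  proof
    fix z assume z: "z \<in> {z \<in> lattice. cmod (x - z) < R}"
    then obtain a b where ab: "Re z = of_int a" "Im z = of_int b" by (auto simp: lattice_def Ints_def)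
    have "\<bar>Re x - Re z\<bar> < R" "\<bar>Im x - Im z\<bar> < R"
      using z abs_Re_le_cmod[of "x - z"] abs_Im_le_cmod[of "x - z"] by auto
    then have "\<lfloor>Re x - R\<rfloor> \<le> a" "a \<le> \<lceil>Re x + R\<rceil>" "\<lfloor>Im x - R\<rfloor> \<le> b" "b \<le> \<lceil>Im x + R\<rceil>"
      unfolding ab by linarith+
    then have "a \<in> ?I (Re x)" "b \<in> ?I (Im x)" by auto
    moreover have "z = Complex (of_int a) (of_int b)" using ab by (simp add: complex_eq_iff)
    ultimately show "z \<in> (\<lambda>(a, b). Complex (of_int a) (of_int b)) ` (?I (Re x) \<times> ?I (Im x))"
      by force
  qed
qed auto

lemma finite_sub_nb [simp]: "finite (sub_nb r0 x)"
  by (rule finite_subset[OF _ finite_lattice_near[of x r0]]) (auto simp: sub_nb_def substrate_def)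

lemma sub_nb_subset_nb: "Im x > 0 \<Longrightarrow> sub_nb r0 x \<subseteq> nb r0 C x"
  by (auto simp: sub_nb_def nb_def substrate_def norm_minus_commute)

lemma finite_nb [simp]: "finite C \<Longrightarrow> finite (nb r0 C x)"
proof -
  assume "finite C"
  moreover have "nb r0 C x \<subseteq> C \<union> sub_nb r0 x"
    by (auto simp: nb_def sub_nb_def norm_minus_commute)
  ultimately show ?thesis using finite_subset[of "nb r0 C x" "C \<union> sub_nb r0 x"] by simp
qed

lemma mem_tri_nb:
  "y \<in> nb r0 C x \<Longrightarrow> z \<in> nb r0 C x \<Longrightarrow> y \<noteq> z \<Longrightarrow> x \<in> C \<Longrightarrow> (y, x, z) \<in> tri r0 C"
  by (auto simp: nb_def tri_def triples_def norm_minus_commute)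

text \<open>One member of the triple lies in the finite set \<open>C\<close> and the other two are
  within 2 r0 of it, where there are only finitely many lattice points.\<close>

lemma finite_tri [simp]:
  assumes "finite C" shows "finite (tri r0 C)"
proof -
  define P where "P = C \<union> (\<Union>c\<in>C. {z \<in> lattice. cmod (c - z) < 2 * r0})"
  have "finite P" using assms finite_lattice_near by (auto simp: P_def)
  moreover have "tri r0 C \<subseteq> P \<times> P \<times> P"
  proof
    fix p assume "p \<in> tri r0 C"
    then obtain x y z where p: "p = (x, y, z)" and t: "(x, y, z) \<in> tri r0 C" by (cases p) auto
    have near: "p \<in> P" if "c \<in> C" "p \<in> C \<union> substrate" "cmod (c - p) < 2 * r0" for c p
      using that by (auto simp: P_def substrate_def)
    have d: "cmod (x - y) < r0" "cmod (y - z) < r0" and r: "r0 > 0"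
      and m: "x \<in> C \<union> substrate" "y \<in> C \<union> substrate" "z \<in> C \<union> substrate"
      using t by (auto simp: tri_def triples_def intro: le_less_trans[OF norm_ge_zero])
    have "cmod (x - z) < 2 * r0"
      using norm_triangle_ineq[of "x - y" "y - z"] d by simp
    with d r have all: "cmod (p - q) < 2 * r0" if "p \<in> {x, y, z}" "q \<in> {x, y, z}" for p q
      using that by (auto simp: norm_minus_commute)
    obtain c where c: "c \<in> C" "c \<in> {x, y, z}" using t by (auto simp: tri_def)
    show "p \<in> P \<times> P \<times> P" using near[OF c(1)] all[OF c(2)] m by (auto simp: p)
  qed
  ultimately show ?thesis by (meson finite_SigmaI finite_subset)
qed

text \<open>\<open>w\<close> is a real-valued stand-in for \<open>v2\<close>, whose infinite values
  are replaced by a large number. \<open>w_min\<close> and \<open>v3_zero\<close> serve the case of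
  equality.\<close>

locale potentials =
  fixes \<beta> \<epsilon> r0 :: real and w v3 :: "real \<Rightarrow> real"
  assumes \<beta>_pos: "\<beta> > 0" and \<epsilon>_pos: "\<epsilon> > 0" and \<epsilon>_less: "\<epsilon> < 1 / 20"
    and r0: "1 < r0" "r0 < sqrt 2"
    and w_ge: "r \<ge> 0 \<Longrightarrow> w r \<ge> - 1"
    and w_min: "r \<ge> 0 \<Longrightarrow> w r = - 1 \<Longrightarrow> r = 1"
    and w_far: "r \<ge> r0 \<Longrightarrow> w r = 0"
    and w_near: "0 \<le> r \<Longrightarrow> r \<le> 1 - \<epsilon> \<Longrightarrow> w r > 1 / \<epsilon>"
    and v3_nonneg: "0 \<le> \<phi> \<Longrightarrow> \<phi> \<le> 2 * pi \<Longrightarrow> v3 \<phi> \<ge> 0"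
    and v3_zero: "0 \<le> \<phi> \<Longrightarrow> \<phi> \<le> 2 * pi \<Longrightarrow> v3 \<phi> = 0 \<Longrightarrow> \<phi> \<in> {pi / 2, pi, 3 * pi / 2}"
    and v3_lin: "\<bar>\<phi> - pi\<bar> \<le> \<epsilon> \<Longrightarrow> v3 \<phi> \<ge> 4 / (pi / 10 - \<epsilon>) * \<bar>\<phi> - pi\<bar>"
    and v3_big: "0 \<le> \<phi> \<Longrightarrow> \<phi> \<le> 2 * pi \<Longrightarrow> \<not> right_angled \<epsilon> \<phi> \<Longrightarrow>
      v3 \<phi> > max 1 (2 * \<beta>) * (4 / (1 - \<epsilon>)^2) * (sqrt 2 + 1/2)^2"
begin

lemma v3_theta_nonneg: "v3 (theta x y z) \<ge> 0"
  using v3_nonneg theta_range[of x y z] by auto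

lemma r0_less: "r0 < 3 / 2"
proof -
  have "sqrt 2 < (3 / 2 :: real)" by (rule real_less_lsqrt) (auto simp: power2_eq_square)
  then show ?thesis using r0 by simp
qed

end

section \<open>Bonds at one particle when all angles are nearly right\<close>

locale good_config = potentials +
  fixes C :: "complex set"
  assumes finC: "finite C" and posC: "x \<in> C \<Longrightarrow> Im x > 0"
    and good: "(x, y, z) \<in> tri r0 C \<Longrightarrow> right_angled \<epsilon> (theta x y z)"
begin

lemma nb_angle: "y \<in> nb r0 C x \<Longrightarrow> z \<in> nb r0 C x \<Longrightarrow> y \<noteq> z \<Longrightarrow> x \<in> C \<Longrightarrow> right_angled \<epsilon> (theta y x z)"
  using good mem_tri_nb by blast

lemma finite_nbC [simp]: "finite (nb r0 C x)"
  using finC by simp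

text \<open>A nearly right angle separates the sector indices by 2 to 8 modulo 10. Hence each
  oriented sector at a particle contains at most one bond, which is why strata do not
  branch.\<close>

lemma nb_dsec_neq:
  assumes "y \<in> nb r0 C x" "z \<in> nb r0 C x" "y \<noteq> z" "x \<in> C"
  shows "dsec t (y - x) \<noteq> dsec t (z - x)"
proof -
  have "y \<noteq> x" "z \<noteq> x" using assms by (auto simp: nb_def)
  then show ?thesis
    using nb_angle[OF assms] dsec_diff[of y x z \<epsilon> t] \<epsilon>_less unfolding right_angled_def by auto
qed

definition opp :: "complex \<Rightarrow> complex \<Rightarrow> complex \<Rightarrow> bool" where
  "opp x y z \<longleftrightarrow> \<bar>theta y x z - pi\<bar> \<le> \<epsilon>"

lemma perp_sec:
  assumes "y \<in> nb r0 C x" "z \<in> nb r0 C x" "y \<noteq> z" "x \<in> C" "\<not> opp x y z"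
  shows "(sec t (y - x) - sec t (z - x)) mod 5 \<in> {2, 3}"
proof -
  define d where "d = dsec t (y - x) - dsec t (z - x)"
  have "y \<noteq> x" "z \<noteq> x" using assms by (auto simp: nb_def)
  then have "d mod 10 \<in> {2, 3, 7, 8}"
    using nb_angle[OF assms(1-4)] dsec_diff[of y x z \<epsilon> t] \<epsilon>_less assms(5)
    unfolding right_angled_def opp_def d_def by auto
  then have "(d mod 10) mod 5 \<in> {2, 3}" by auto
  then have "d mod 5 \<in> {2, 3}" by (simp add: mod_mod_cancel)
  then show ?thesis by (simp add: sec_def d_def mod_simps)
qed

lemma right_angled_quarter: "right_angled \<epsilon> \<phi> \<Longrightarrow> \<exists>k\<in>{1, 2, 3::int}. \<bar>\<phi> - of_int k * pi / 2\<bar> \<le> \<epsilon>"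
  unfolding right_angled_def by auto

text \<open>Angles around \<open>x\<close> add up modulo 2 pi. The three rounding errors total at
  most 3 \<epsilon>, less than a quarter turn, so the numbers of quarter turns add up modulo
  4.\<close>

lemma quarter_add:
  assumes "y \<noteq> x" "z \<noteq> x" "u \<noteq> x"
    and "\<bar>theta y x u - of_int k1 * pi / 2\<bar> \<le> \<epsilon>" "\<bar>theta z x u - of_int k2 * pi / 2\<bar> \<le> \<epsilon>"
    "\<bar>theta y x z - of_int k3 * pi / 2\<bar> \<le> \<epsilon>"
  shows "(k3 - k1 + k2) mod 4 = 0"
proof -
  obtain m1 m2 m3 :: int where
    "Arg (y - x) = Arg (u - x) + theta y x u + 2 * pi * of_int m1"
    "Arg (z - x) = Arg (u - x) + theta z x u + 2 * pi * of_int m2"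
    "Arg (y - x) = Arg (z - x) + theta y x z + 2 * pi * of_int m3"
    using theta_Arg[of y x u] theta_Arg[of z x u] theta_Arg[of y x z] assms(1-3) by metis
  then have "theta y x z - theta y x u + theta z x u = 2 * pi * of_int (m1 - m2 - m3)"
    by (simp add: algebra_simps)
  define m where "m = m1 - m2 - m3"
  define e where "e = (theta y x z - of_int k3 * pi / 2) - (theta y x u - of_int k1 * pi / 2)
    + (theta z x u - of_int k2 * pi / 2)"
  have e: "\<bar>e\<bar> \<le> 3 * \<epsilon>" unfolding e_def using assms(4-6) by linarith
  have "e = (pi / 2) * of_int (4 * m - (k3 - k1 + k2))"
    using \<open>_ = 2 * pi * of_int (m1 - m2 - m3)\<close> by (simp add: e_def m_def algebra_simps)
  then have "\<bar>e\<bar> = (pi / 2) * \<bar>of_int (4 * m - (k3 - k1 + k2))\<bar>"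
    by (simp only: abs_mult) simp
  then have "(pi / 2) * \<bar>of_int (4 * m - (k3 - k1 + k2))\<bar> < (pi / 2) * 1"
    using e \<epsilon>_less pi_gt3 by linarith
  then have "\<bar>real_of_int (4 * m - (k3 - k1 + k2))\<bar> < 1" by simp
  then have "4 * m = k3 - k1 + k2" by linarith
  then show ?thesis by presburger
qed

text \<open>Two bonds opposite to \<open>u\<close> would differ by a whole number of turns, but
  nearly right angles exclude an angle near 0.\<close>

lemma opp_opp:
  assumes "y \<in> nb r0 C x" "z \<in> nb r0 C x" "u \<in> nb r0 C x" "y \<noteq> z" "y \<noteq> u" "z \<noteq> u" "x \<in> C"
    and "opp x y u" "opp x z u"
  shows False
proof -
  have ne: "y \<noteq> x" "z \<noteq> x" "u \<noteq> x" using assms by (auto simp: nb_def)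
  obtain k where k: "k \<in> {1, 2, 3::int}" "\<bar>theta y x z - of_int k * pi / 2\<bar> \<le> \<epsilon>"
    using right_angled_quarter nb_angle assms by metis
  have "(k - 2 + 2) mod 4 = 0"
    by (rule quarter_add[OF ne]) (use assms k in \<open>auto simp: opp_def\<close>)
  then show False using k by auto
qed

text \<open>Both bonds are an odd number of quarter turns away from \<open>u\<close>, so they differ
  by an even number, and this is not 0. With \<open>opp_opp\<close> it splits the bonds at
  \<open>x\<close> into the axis of \<open>u\<close> and one perpendicular axis.\<close>

lemma perp_perp:
  assumes "y \<in> nb r0 C x" "z \<in> nb r0 C x" "u \<in> nb r0 C x" "y \<noteq> z" "y \<noteq> u" "z \<noteq> u" "x \<in> C"
    and "\<not> opp x y u" "\<not> opp x z u"
  shows "opp x y z"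
proof -
  have ne: "y \<noteq> x" "z \<noteq> x" "u \<noteq> x" using assms by (auto simp: nb_def)
  obtain k where k: "k \<in> {1, 2, 3::int}" "\<bar>theta y x z - of_int k * pi / 2\<bar> \<le> \<epsilon>"
    using right_angled_quarter nb_angle assms by metis
  obtain k1 where k1: "k1 \<in> {1, 2, 3::int}" "\<bar>theta y x u - of_int k1 * pi / 2\<bar> \<le> \<epsilon>"
    using right_angled_quarter nb_angle assms by metis
  obtain k2 where k2: "k2 \<in> {1, 2, 3::int}" "\<bar>theta z x u - of_int k2 * pi / 2\<bar> \<le> \<epsilon>"
    using right_angled_quarter nb_angle assms by metis
  have "k1 \<noteq> 2" "k2 \<noteq> 2" using k1 k2 assms(8,9) by (auto simp: opp_def)
  moreover have "(k - k1 + k2) mod 4 = 0" by (rule quarter_add[OF ne k1(2) k2(2) k(2)])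
  ultimately have "k = 2" using k(1) k1(1) k2(1) by auto
  then show ?thesis using k by (simp add: opp_def)
qed

section \<open>Cuts and their price\<close>

definition cuts :: "real \<Rightarrow> complex \<Rightarrow> (complex \<times> complex) set" where
  "cuts t x = {(y, z). y \<in> nb r0 C x \<and> z \<in> nb r0 C x \<and> y \<noteq> z \<and> opp x y z \<and> sec t (y - x) \<noteq> sec t (z - x)}"

lemma finite_cuts [simp]: "finite (cuts t x)"
  by (rule finite_subset[of _ "nb r0 C x \<times> nb r0 C x"]) (auto simp: cuts_def)

text \<open>Fix one bond \<open>y\<close> of the axis: any sector other than that of
  \<open>y\<close> is the sector of some \<open>z\<close> for which (y, z) is a cut.\<close>

lemma card_sec_axis:
  assumes "X \<subseteq> nb r0 C x" "\<And>y z. y \<in> X \<Longrightarrow> z \<in> X \<Longrightarrow> y \<noteq> z \<Longrightarrow> opp x y z"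
  shows "card ((\<lambda>y. sec t (y - x)) ` X) \<le> 1 + card (cuts t x \<inter> X \<times> X)"
proof (cases "X = {}")
  case False
  then obtain y where y: "y \<in> X" by auto
  have "(\<lambda>y. sec t (y - x)) ` X \<subseteq>
      insert (sec t (y - x)) ((\<lambda>(y, z). sec t (z - x)) ` (cuts t x \<inter> X \<times> X))"
  proof
    fix s assume "s \<in> (\<lambda>y. sec t (y - x)) ` X"
    then obtain z where z: "z \<in> X" "s = sec t (z - x)" by auto
    show "s \<in> insert (sec t (y - x)) ((\<lambda>(y, z). sec t (z - x)) ` (cuts t x \<inter> X \<times> X))"
    proof (cases "s = sec t (y - x)")
      case False
      then have "(y, z) \<in> cuts t x \<inter> X \<times> X" using y z assms by (auto simp: cuts_def)
      then show ?thesis using z by force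
    qed simp
  qed
  then have "card ((\<lambda>y. sec t (y - x)) ` X) \<le>
      card (insert (sec t (y - x)) ((\<lambda>(y, z). sec t (z - x)) ` (cuts t x \<inter> X \<times> X)))"
    by (intro card_mono) auto
  also have "\<dots> \<le> Suc (card ((\<lambda>(y, z). sec t (z - x)) ` (cuts t x \<inter> X \<times> X)))"
    by (rule card_insert_le_m1) auto
  also have "\<dots> \<le> 1 + card (cuts t x \<inter> X \<times> X)" by (simp add: card_image_le)
  finally show ?thesis .
qed simp

text \<open>A particle whose bonds occupy fewer than two axes receives virtual perpendicular sectors;
  each axis occupies one sector, plus one for each cut.\<close>

lemma exists_sectors:
  assumes "x \<in> C"
  obtains S k1 k2 where "(\<lambda>y. sec t (y - x)) ` nb r0 C x \<subseteq> S" "S \<subseteq> {0..<5}"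
    "card S \<le> 2 + card (cuts t x)" "k1 \<in> S" "k2 \<in> S" "(k1 - k2) mod 5 \<in> {2, 3}"
proof (cases "nb r0 C x = {}")
  case True
  then show thesis by (intro that[of "{0, 2}" 2 0]) auto
next
  case False
  then obtain u where u: "u \<in> nb r0 C x" by auto
  define s where "s = (\<lambda>y. sec t (y - x))"
  have s_bounds: "s ` X \<subseteq> {0..<5}" for X using sec_bounds by (auto simp: s_def)
  \<comment> \<open>\<open>X\<close> is the axis of \<open>u\<close> and \<open>Y\<close> the
    perpendicular one. Cuts occur within an axis only, and the products \<open>X \<times> X\<close>
    and \<open>Y \<times> Y\<close> are disjoint, so no cut is charged twice.\<close>
  define X where "X = {y \<in> nb r0 C x. y = u \<or> opp x y u}"
  define Y where "Y = nb r0 C x - X"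
  have opp_commute: "opp x z y" if "opp x y z" "y \<noteq> x" "z \<noteq> x" for y z
    using that theta_swap[of y x z] pi_gt3 \<epsilon>_less by (auto simp: opp_def split: if_splits)
  have cX: "card (s ` X) \<le> 1 + card (cuts t x \<inter> X \<times> X)" unfolding s_def
  proof (rule card_sec_axis)
    show "X \<subseteq> nb r0 C x" by (auto simp: X_def)
    show "opp x y z" if "y \<in> X" "z \<in> X" "y \<noteq> z" for y z
      using that opp_opp[of y x z u] opp_commute[of z u] u assms by (auto simp: X_def nb_def)
  qed
  have cY: "card (s ` Y) \<le> 1 + card (cuts t x \<inter> Y \<times> Y)" unfolding s_def
  proof (rule card_sec_axis)
    show "Y \<subseteq> nb r0 C x" by (auto simp: Y_def)
    show "opp x y z" if "y \<in> Y" "z \<in> Y" "y \<noteq> z" for y z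
      using that perp_perp[of y x z u] u assms by (auto simp: Y_def X_def)
  qed
  have "card (cuts t x \<inter> X \<times> X) + card (cuts t x \<inter> Y \<times> Y) =
      card (cuts t x \<inter> X \<times> X \<union> cuts t x \<inter> Y \<times> Y)"
    by (intro card_Un_disjoint[symmetric]) (auto simp: Y_def)
  also have "\<dots> \<le> card (cuts t x)" by (intro card_mono) auto
  finally have cXY: "card (cuts t x \<inter> X \<times> X) + card (cuts t x \<inter> Y \<times> Y) \<le> card (cuts t x)" .
  have nbXY: "nb r0 C x = X \<union> Y" by (auto simp: Y_def X_def)
  have uX: "u \<in> X" using u by (simp add: X_def)
  show thesis
  proof (cases "Y = {}")
    case True
    define k where "k = (s u + 2) mod 5"
    have "card (insert k (s ` X)) \<le> Suc (card (s ` X))" by (rule card_insert_le_m1) auto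
    moreover have "(k - s u) mod 5 \<in> {2, 3}" by (simp add: k_def mod_simps)
    moreover have "insert k (s ` X) \<subseteq> {0..<5}" using s_bounds[of X] by (auto simp: k_def)
    ultimately show thesis
      using True nbXY cX cXY uX by (intro that[of "insert k (s ` X)" k "s u"]) (auto simp: s_def)
  next
    case False
    then obtain v where v: "v \<in> Y" by auto
    have "(s v - s u) mod 5 \<in> {2, 3}" unfolding s_def
      using v u assms by (intro perp_sec) (auto simp: Y_def X_def)
    moreover have "card (s ` X \<union> s ` Y) \<le> card (s ` X) + card (s ` Y)" by (rule card_Un_le)
    ultimately show thesis using s_bounds[of X] s_bounds[of Y] nbXY cX cY cXY uX v
      by (intro that[of "s ` X \<union> s ` Y" "s v" "s u"]) (auto simp: s_def image_Un)
  qed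
qed

text \<open>The two bonds of a nearly straight angle have unoriented directions that differ by
  |theta - pi|, and a cut means that a sector boundary falls between them. A good offset from
  \<open>exists_offset\<close> bounds the cuts by the total bend, and \<open>v3_lin\<close> bounds
  the bend by \<open>v3\<close>.\<close>

lemma exists_few_cuts:
  obtains t where "real (\<Sum>x\<in>C. card (cuts t x)) \<le> (\<Sum>(x, y, z)\<in>tri r0 C. v3 (theta x y z)) / 4"
proof -
  define I where "I = {(y, x, z). x \<in> C \<and> y \<in> nb r0 C x \<and> z \<in> nb r0 C x \<and> y \<noteq> z \<and> opp x y z}"
  have I_tri: "I \<subseteq> tri r0 C" using mem_tri_nb by (auto simp: I_def)
  have finI: "finite I" using I_tri finC by (meson finite_subset finite_tri)
  define b where "b = (\<lambda>(y :: complex, x, z). 5 * Arg (z - x) / pi)"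
  \<comment> \<open>\<open>a\<close> is the direction of y - x in units of sectors, corrected by a
    multiple of 5 so that it lies close to \<open>b\<close>; \<open>sec\<close> does not see this
    correction.\<close>
  define a where "a = (\<lambda>(y, x, z). 5 * Arg (z - x) / pi + 5 * (theta y x z - pi) / pi)"
  obtain t where t: "real (card {i \<in> I. \<lfloor>a i - t\<rfloor> \<noteq> \<lfloor>b i - t\<rfloor>}) \<le> 2 * (\<Sum>i\<in>I. \<bar>a i - b i\<bar>)"
    using exists_offset[OF finI] by blast
  have sec_a: "sec t (y - x) = \<lfloor>a (y, x, z) - t\<rfloor> mod 5" if "y \<noteq> x" "z \<noteq> x" for y x z
  proof -
    obtain m where m: "Arg (y - x) = Arg (z - x) + theta y x z + 2 * pi * of_int m"
      using theta_Arg \<open>y \<noteq> x\<close> \<open>z \<noteq> x\<close> by blast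
    have "5 * Arg (y - x) / pi - t = (a (y, x, z) - t) + of_int (5 * (1 + 2 * m))"
      by (simp add: m a_def field_simps)
    then have "\<lfloor>5 * Arg (y - x) / pi - t\<rfloor> = \<lfloor>a (y, x, z) - t\<rfloor> + 5 * (1 + 2 * m)"
      by (simp only: floor_add_int)
    then show ?thesis unfolding sec_eq by (simp only: mod_mult_self2)
  qed
  have "(\<Sum>x\<in>C. card (cuts t x)) = card (Sigma C (cuts t))" using finC by simp
  also have "\<dots> \<le> card {i \<in> I. \<lfloor>a i - t\<rfloor> \<noteq> \<lfloor>b i - t\<rfloor>}"
  proof (rule card_inj_on_le[where f = "\<lambda>(x, y, z). (y, x, z)"])
    show "(\<lambda>(x, y, z). (y, x, z)) ` Sigma C (cuts t) \<subseteq> {i \<in> I. \<lfloor>a i - t\<rfloor> \<noteq> \<lfloor>b i - t\<rfloor>}"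
    proof clarify
      fix x y z assume x: "x \<in> C" and c: "(y, z) \<in> cuts t x"
      then have ne: "y \<noteq> x" "z \<noteq> x" by (auto simp: cuts_def nb_def)
      have "sec t (z - x) = \<lfloor>b (y, x, z) - t\<rfloor> mod 5" by (simp add: sec_eq b_def)
      moreover have "sec t (y - x) \<noteq> sec t (z - x)" using c by (auto simp: cuts_def)
      ultimately have "\<lfloor>a (y, x, z) - t\<rfloor> \<noteq> \<lfloor>b (y, x, z) - t\<rfloor>" using sec_a[OF ne] by auto
      then show "(y, x, z) \<in> I \<and> \<lfloor>a (y, x, z) - t\<rfloor> \<noteq> \<lfloor>b (y, x, z) - t\<rfloor>"
        using x c by (auto simp: cuts_def I_def)
    qed
    show "inj_on (\<lambda>(x, y, z). (y, x, z)) (Sigma C (cuts t))" by (auto simp: inj_on_def)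
    show "finite {i \<in> I. \<lfloor>a i - t\<rfloor> \<noteq> \<lfloor>b i - t\<rfloor>}" using finI by simp
  qed
  finally have "real (\<Sum>x\<in>C. card (cuts t x)) \<le> 2 * (\<Sum>i\<in>I. \<bar>a i - b i\<bar>)" using t by linarith
  also have "\<dots> = (\<Sum>i\<in>I. 2 * \<bar>a i - b i\<bar>)" by (simp add: sum_distrib_left)
  also have "\<dots> \<le> (\<Sum>(x, y, z)\<in>I. v3 (theta x y z) / 4)"
  proof (rule sum_mono, clarify)
    fix y x z assume i: "(y, x, z) \<in> I"
    define d where "d = \<bar>theta y x z - pi\<bar>"
    have "\<bar>a (y, x, z) - b (y, x, z)\<bar> = \<bar>5 * (theta y x z - pi) / pi\<bar>" by (simp add: a_def b_def)
    also have "\<dots> = 5 / pi * d" unfolding d_def by (simp only: abs_mult abs_divide) simp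
    \<comment> \<open>The factor 2 of \<open>exists_offset\<close> times 5 / pi equals 10 / pi, a
      quarter of 4 / (pi / 10).\<close>
    finally have "2 * \<bar>a (y, x, z) - b (y, x, z)\<bar> = (4 / (pi / 10)) * d / 4" by simp
    also have "\<dots> \<le> (4 / (pi / 10 - \<epsilon>)) * d / 4"
      using \<epsilon>_pos \<epsilon>_less pi_gt3 by (intro divide_right_mono mult_right_mono divide_left_mono) (auto simp: d_def)
    also have "\<dots> \<le> v3 (theta y x z) / 4"
      unfolding d_def by (rule divide_right_mono[OF v3_lin]) (use i in \<open>auto simp: I_def opp_def\<close>)
    finally show "2 * \<bar>a (y, x, z) - b (y, x, z)\<bar> \<le> v3 (theta y x z) / 4" .
  qed
  also have "\<dots> \<le> (\<Sum>(x, y, z)\<in>tri r0 C. v3 (theta x y z) / 4)"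
    using I_tri finC v3_theta_nonneg by (intro sum_mono2) auto
  also have "\<dots> = (\<Sum>(x, y, z)\<in>tri r0 C. v3 (theta x y z)) / 4"
    unfolding sum_divide_distrib by (intro sum.cong) auto
  finally show thesis by (rule that)
qed

text \<open>The lattice neighbours of a substrate atom occupy all directions but the upward one.\<close>

lemma substrate_bond_angle:
  assumes x: "x \<in> C" and s: "s \<in> sub_nb r0 x"
  shows "Im s = 0" "\<bar>Arg (x - s) - pi / 2\<bar> \<le> \<epsilon>" "(x, s, s + 1) \<in> tri r0 C" "theta x s (s + 1) = Arg (x - s)"
proof -
  have sub: "s \<in> substrate" and d: "cmod (x - s) < r0" using s by (auto simp: sub_nb_def)
  have xs: "x \<noteq> s" and "x \<notin> substrate" using posC[OF x] sub by (auto simp: substrate_def)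
  have mem: "(x, s, s + u) \<in> tri r0 C" if "s + u \<in> substrate" "cmod u = 1" for u
    using that x sub xs \<open>x \<notin> substrate\<close> d r0(1)
    by (auto simp: tri_def triples_def norm_minus_commute)
  have s1: "s + 1 \<in> substrate" and sm1: "s + (- 1) \<in> substrate" and smi: "s + (- \<i>) \<in> substrate"
    using sub by (auto simp: substrate_def lattice_def)
  have Im_pos: "0 < Im (x - s)" using posC[OF x] sub by (simp add: substrate_def)
  then have Apos: "0 < Arg (x - s)" "Arg (x - s) < pi" using Arg_lt_pi[of "x - s"] by auto
  show th1: "theta x s (s + 1) = Arg (x - s)"
    using Apos by (intro theta_eqI[where m = 0]) (use xs in auto)
  show tri1: "(x, s, s + 1) \<in> tri r0 C" using mem[OF s1] by simp
  have g1: "right_angled \<epsilon> (Arg (x - s))" using good[OF tri1] th1 by simp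
  have "theta x s (s + (- 1)) = Arg (x - s) + pi"
    using Apos xs Arg_of_real[of "- 1"] by (intro theta_eqI[where m = "- 1"]) auto
  then have g2: "right_angled \<epsilon> (Arg (x - s) + pi)" using good[OF mem[OF sm1]] by simp
  \<comment> \<open>The neighbour s + 1 allows \<open>Arg (x - s)\<close> near pi/2 or pi, the
    neighbour s - 1 allows it near 0 or pi/2.\<close>
  show A: "\<bar>Arg (x - s) - pi / 2\<bar> \<le> \<epsilon>"
    using g1 g2 Apos \<epsilon>_less pi_gt3 unfolding right_angled_def by (auto simp: abs_le_iff)
  \<comment> \<open>Below the top row the atom s + i would also belong to the substrate and would
    lie in nearly the same direction as \<open>x\<close>, at an angle near 0 or 2 pi.\<close>
  show "Im s = 0"
  proof (rule ccontr)
    assume "Im s \<noteq> 0"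
    obtain k where k: "Im s = of_int k" using sub by (auto simp: substrate_def lattice_def Ints_def)
    have "k < 0" using \<open>Im s \<noteq> 0\<close> k sub by (auto simp: substrate_def)
    then have "Im s + 1 \<le> 0" using k by simp
    then have si: "s + \<i> \<in> substrate" using sub by (auto simp: substrate_def lattice_def)
    have r: "right_angled \<epsilon> (theta x s (s + \<i>))" using good[OF mem[OF si]] by simp
    show False
    proof (cases "Arg (x - s) < pi / 2")
      case True
      then have "theta x s (s + \<i>) = Arg (x - s) + 3 * pi / 2"
        using Apos xs by (intro theta_eqI[where m = "- 1"]) auto
      then show False using r A \<epsilon>_less pi_gt3 unfolding right_angled_def by (auto simp: abs_le_iff)
    next
      case False
      then have "theta x s (s + \<i>) = Arg (x - s) - pi / 2"
        using Apos xs by (intro theta_eqI[where m = 0]) auto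
      then show False using r A \<epsilon>_less pi_gt3 unfolding right_angled_def by (auto simp: abs_le_iff)
    qed
  qed
qed

text \<open>Seen from \<open>x\<close>, every foot lies within \<epsilon> of straight down. Two feet
  would thus enclose an angle near a multiple of 2 pi, which is not nearly right.\<close>

lemma substrate_bond_unique:
  assumes "x \<in> C" "s \<in> sub_nb r0 x" "s' \<in> sub_nb r0 x" shows "s = s'"
proof (rule ccontr)
  assume ne: "s \<noteq> s'"
  have nbs: "s \<in> nb r0 C x" "s' \<in> nb r0 C x" and nex: "s \<noteq> x" "s' \<noteq> x"
    using sub_nb_subset_nb[OF posC[OF assms(1)]] assms by (auto simp: nb_def)
  obtain m where m: "Arg (s - x) = Arg (s' - x) + theta s x s' + 2 * pi * of_int m"
    using theta_Arg nex by blast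
  have A: "\<bar>Arg (u - x) + pi / 2\<bar> \<le> \<epsilon>" if "u \<in> sub_nb r0 x" for u
  proof -
    have "Im (u - x) < 0" using that posC[OF assms(1)] by (auto simp: sub_nb_def substrate_def)
    then have "Arg (u - x) < 0" by (simp add: Arg_neg_iff)
    have "x - u \<noteq> 0" using \<open>Im (u - x) < 0\<close> by auto
    then have "Arg (u - x) = Arg (x - u) - pi"
      using Arg_minus[of "x - u"] substrate_bond_angle(2)[OF assms(1) that] \<epsilon>_less pi_gt3
      by (auto split: if_splits)
    then show ?thesis using substrate_bond_angle(2)[OF assms(1) that] by (simp add: abs_le_iff)
  qed
  have "\<bar>theta s x s' + 2 * pi * of_int m\<bar> \<le> 2 * \<epsilon>" using A[OF assms(2)] A[OF assms(3)] m by linarith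
  moreover have "pi / 2 - \<epsilon> \<le> theta s x s'" "theta s x s' \<le> 3 * pi / 2 + \<epsilon>"
    using nb_angle[OF nbs ne assms(1)] \<epsilon>_less pi_gt3 unfolding right_angled_def by auto
  ultimately have "0 < - of_int m * (2 * pi)" "- of_int m * (2 * pi) < 1 * (2 * pi)"
    using \<epsilon>_less pi_gt3 by (simp_all add: mult.commute; linarith)+
  then have "0 < - real_of_int m" "- real_of_int m < 1"
    using pi_gt_zero mult_less_cancel_right_pos[of "2 * pi" "- real_of_int m" 1]
    by (simp_all only: zero_less_mult_iff) auto
  then have "m < 0" "- 1 < m" by linarith+
  then show False by simp
qed

text \<open>The possible directions fill an arc of a fifth of a sector around 5/2, so they meet at
  most two consecutive sectors; \<open>5/2 - 1/10\<close> is the lower end of this arc.\<close>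

lemma substrate_bond_dsec:
  assumes "x \<in> C" "s \<in> sub_nb r0 x"
  shows "dsec t (x - s) \<in> {\<lfloor>5 / 2 - 1 / 10 - t\<rfloor> mod 10, (\<lfloor>5 / 2 - 1 / 10 - t\<rfloor> + 1) mod 10}"
proof -
  have "\<bar>5 * Arg (x - s) / pi - 5 / 2\<bar> = 5 * \<bar>Arg (x - s) - pi / 2\<bar> / pi"
    using pi_gt3 by (simp add: abs_if field_simps)
  also have "\<dots> \<le> (1/4) / pi"
    using substrate_bond_angle(2)[OF assms] \<epsilon>_less by (intro divide_right_mono) auto
  also have "\<dots> \<le> 1/10" using pi_gt3 by (simp add: field_simps)
  finally have "\<bar>5 * Arg (x - s) / pi - 5 / 2\<bar> \<le> 1 / 10" .
  then have "\<lfloor>5 * Arg (x - s) / pi - t\<rfloor> = \<lfloor>5 / 2 - 1 / 10 - t\<rfloor> \<or>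
      \<lfloor>5 * Arg (x - s) / pi - t\<rfloor> = \<lfloor>5 / 2 - 1 / 10 - t\<rfloor> + 1" by linarith
  then show ?thesis by (auto simp: dsec_def)
qed

end

section \<open>Strata\<close>

text \<open>The data supplied by \<open>exists_sectors\<close> at a common offset \<open>t\<close>:
  \<open>S x\<close> holds the sectors of strata through \<open>x\<close>, virtual ones included,
  and \<open>k1 x\<close>, \<open>k2 x\<close> are a nearly perpendicular pair among them.\<close>

locale strata = good_config +
  fixes t :: real and S :: "complex \<Rightarrow> int set" and k1 k2 :: "complex \<Rightarrow> int"
  assumes S_sec: "x \<in> C \<Longrightarrow> (\<lambda>y. sec t (y - x)) ` nb r0 C x \<subseteq> S x"
    and S_bounds: "x \<in> C \<Longrightarrow> S x \<subseteq> {0..<5}"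
    and k1: "x \<in> C \<Longrightarrow> k1 x \<in> S x" and k2: "x \<in> C \<Longrightarrow> k2 x \<in> S x"
    and k1_k2: "x \<in> C \<Longrightarrow> (k1 x - k2 x) mod 5 \<in> {2, 3}"
begin

definition bonds :: "(complex \<times> complex) set" where
  "bonds = {(x, y). x \<in> C \<and> y \<in> C \<and> x \<noteq> y \<and> cmod (x - y) < r0}"

text \<open>Oriented bonds. For \<open>k\<close> in {0..<5} only one of the two orientations of a
  sector is used, so each bond occurs once; chains in \<open>R k\<close> are the strata.\<close>

definition R :: "int \<Rightarrow> (complex \<times> complex) set" where
  "R k = {(x, y). (x, y) \<in> bonds \<and> dsec t (y - x) = k}"

lemma finite_bonds [simp]: "finite bonds"
  by (rule finite_subset[of _ "C \<times> C"]) (auto simp: bonds_def finC)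

lemma R_subset: "R k \<subseteq> bonds"
  by (auto simp: R_def)

lemma finite_R [simp]: "finite (R k)"
  using finite_subset[OF R_subset] by simp

lemma sym_bonds: "sym bonds"
  by (auto simp: sym_def bonds_def norm_minus_commute)

lemma bonds_nb: "(x, y) \<in> bonds \<Longrightarrow> x \<in> C \<and> y \<in> C \<and> y \<in> nb r0 C x \<and> x \<in> nb r0 C y"
  by (auto simp: bonds_def nb_def norm_minus_commute)

lemma R_rev: "(x, y) \<in> R k \<Longrightarrow> dsec t (x - y) = (k + 5) mod 10"
  using dsec_uminus[of "y - x" t] by (auto simp: R_def bonds_def)

lemma single_valued_R: "single_valued (R k)"
proof (rule single_valuedI)
  fix x y z assume "(x, y) \<in> R k" "(x, z) \<in> R k"
  then have "y \<in> nb r0 C x" "z \<in> nb r0 C x" "x \<in> C" "dsec t (y - x) = dsec t (z - x)"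
    using bonds_nb by (auto simp: R_def)
  then show "y = z" using nb_dsec_neq by blast
qed

lemma single_valued_R_converse: "single_valued ((R k)\<inverse>)"
proof (rule single_valuedI)
  fix x y z assume "(x, y) \<in> (R k)\<inverse>" "(x, z) \<in> (R k)\<inverse>"
  then have r: "(y, x) \<in> R k" "(z, x) \<in> R k" by auto
  then have "y \<in> nb r0 C x" "z \<in> nb r0 C x" "x \<in> C" using bonds_nb R_subset by blast+
  then show "y = z" using nb_dsec_neq[of y x z t] R_rev[OF r(1)] R_rev[OF r(2)] by metis
qed

text \<open>Displacements add within a convex cone, by \<open>dsec_add\<close>. This makes
  \<open>R k\<close> acyclic and determines the sector of the chord between any two particles of one
  stratum.\<close>

lemma trancl_R:
  assumes "(x, y) \<in> (R k)\<^sup>+" shows "x \<noteq> y \<and> dsec t (y - x) = k"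
  using assms
proof (induction rule: trancl_induct)
  case (base y)
  then show ?case by (auto simp: R_def bonds_def)
next
  case (step y z)
  have yz: "z - y \<noteq> 0" "dsec t (z - y) = k" using step.hyps by (auto simp: R_def bonds_def)
  have "(y - x) + (z - y) \<noteq> 0 \<and> dsec t ((y - x) + (z - y)) = k"
    using dsec_add[of "y - x" "z - y" t] step.IH yz by auto
  then show ?case by auto
qed

text \<open>Reversing a bond exchanges the oriented sectors below 5 with those from 5 on.\<close>

lemma sum_card_R: "2 * (\<Sum>k\<in>{0..<5}. card (R k)) = card bonds"
proof -
  define P where "P = {(x, y) \<in> bonds. dsec t (y - x) < 5}"
  define Q where "Q = {(x, y) \<in> bonds. \<not> dsec t (y - x) < 5}"
  have "card P = card Q"
  proof (rule bij_betw_same_card[of prod.swap], rule bij_betw_imageI)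
    have flip: "dsec t (x - y) < 5 \<longleftrightarrow> \<not> dsec t (y - x) < 5" if "(x, y) \<in> bonds" for x y
    proof -
      have "dsec t (x - y) = (dsec t (y - x) + 5) mod 10"
        using that dsec_uminus[of "y - x" t] by (auto simp: bonds_def)
      then show ?thesis using dsec_bounds[of t "y - x"] by presburger
    qed
    have swap: "(y, x) \<in> P \<longleftrightarrow> (x, y) \<in> Q" for x y
      using flip[of x y] symD[OF sym_bonds] unfolding P_def Q_def by blast
    show "prod.swap ` P = Q"
    proof (intro equalityI subsetI)
      fix p assume "p \<in> prod.swap ` P"
      then show "p \<in> Q" using swap by auto
    next
      fix p assume "p \<in> Q"
      then have "prod.swap p \<in> P" using swap by (cases p) auto
      then show "p \<in> prod.swap ` P" by (metis image_eqI swap_swap)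
    qed
  qed auto
  moreover have "bonds = P \<union> Q" "P \<inter> Q = {}" by (auto simp: P_def Q_def)
  moreover have "finite P" "finite Q" by (auto simp: P_def Q_def intro: finite_subset[OF _ finite_bonds])
  ultimately have "card bonds = 2 * card P" by (simp add: card_Un_disjoint)
  moreover have "P = (\<Union>k\<in>{0..<5}. R k)" using dsec_bounds by (auto simp: P_def R_def)
  moreover have "card (\<Union>k\<in>{0..<5}. R k) = (\<Sum>k\<in>{0..<5}. card (R k))"
    by (rule card_UN_disjoint) (simp, simp, auto simp: R_def)
  ultimately show ?thesis by simp
qed

text \<open>A stratum is encoded by its last particle together with its label. Since the chains are
  disjoint paths on the nodes (x, k), counting ends counts strata, including those of a single
  particle.\<close>

definition ends :: "(complex \<times> int) set" where
  "ends = {(x, k). x \<in> C \<and> k \<in> S x \<and> x \<notin> Domain (R k)}"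

lemma finite_nodes: "finite (Sigma C S)"
  using finC S_bounds finite_subset by blast

lemma finite_ends [simp]: "finite ends"
  by (rule finite_subset[OF _ finite_nodes]) (auto simp: ends_def)

lemma sec_mem_S: "x \<in> C \<Longrightarrow> y \<in> nb r0 C x \<Longrightarrow> sec t (y - x) \<in> S x"
  using S_sec by blast

lemma R_mem_S:
  assumes "(x, y) \<in> R k" "k \<in> {0..<5}" shows "k \<in> S x" "k \<in> S y"
proof -
  have xy: "(x, y) \<in> bonds" and d: "dsec t (y - x) = k" using assms(1) by (auto simp: R_def)
  have b: "x \<in> C" "y \<in> C" "y \<in> nb r0 C x" "x \<in> nb r0 C y" using bonds_nb[OF xy] by blast+
  have ne: "y - x \<noteq> 0" using xy by (auto simp: bonds_def)
  have "sec t (y - x) = k" using d assms(2) by (simp add: sec_def)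
  moreover from this have "sec t (x - y) = k" using sec_uminus[OF ne, of t] by simp
  ultimately show "k \<in> S x" "k \<in> S y" using sec_mem_S b by metis+
qed

text \<open>Disjoint paths number nodes minus edges: a node is either an end or has exactly one
  successor. This converts a bound on the sectors into a bound on the bonds.\<close>

lemma card_ends: "card ends + (\<Sum>k\<in>{0..<5}. card (R k)) = (\<Sum>x\<in>C. card (S x))"
proof -
  define D where "D = (\<Union>k\<in>{0..<5}. Domain (R k) \<times> {k})"
  have "Sigma C S = ends \<union> D"
  proof (intro equalityI subsetI)
    fix p assume "p \<in> Sigma C S"
    then obtain x k where p: "p = (x, k)" "x \<in> C" "k \<in> S x" by auto
    then have "k \<in> {0..<5}" using S_bounds by blast
    then show "p \<in> ends \<union> D" using p by (auto simp: ends_def D_def)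
  next
    fix p assume p: "p \<in> ends \<union> D"
    show "p \<in> Sigma C S"
    proof (cases "p \<in> ends")
      case False
      then obtain x y k where "p = (x, k)" "(x, y) \<in> R k" "k \<in> {0..<5}" using p by (auto simp: D_def)
      then show ?thesis using R_mem_S bonds_nb R_subset by blast
    qed (auto simp: ends_def)
  qed
  moreover have "ends \<inter> D = {}" by (auto simp: ends_def D_def)
  moreover have "finite D" by (auto simp: D_def finite_Domain)
  ultimately have "card (Sigma C S) = card ends + card D" by (simp add: card_Un_disjoint)
  moreover have "card (Sigma C S) = (\<Sum>x\<in>C. card (S x))"
    using finC S_bounds finite_subset by (intro card_SigmaI) blast+
  moreover have "card D = (\<Sum>k\<in>{0..<5}. card (Domain (R k) \<times> {k}))"
    unfolding D_def by (rule card_UN_disjoint) (auto simp: finite_Domain)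
  moreover have "card (Domain (R k)) = card (R k)" for k
  proof -
    have "inj_on fst (R k)"
      using single_valued_R[of k] by (auto simp: inj_on_def single_valued_def)
    then show ?thesis unfolding Domain_fst by (rule card_image)
  qed
  ultimately show ?thesis by (simp add: card_cartesian_product)
qed

text \<open>The last particle met when sector \<open>k\<close> is followed from \<open>x\<close>;
  the pair (stop x k, k) names the stratum through \<open>x\<close>.\<close>

definition stop :: "complex \<Rightarrow> int \<Rightarrow> complex" where
  "stop x k = (SOME z. (x, z) \<in> (R k)\<^sup>* \<and> z \<notin> Domain (R k))"

lemma stop: "(x, stop x k) \<in> (R k)\<^sup>*" "stop x k \<notin> Domain (R k)"
proof -
  have "acyclic (R k)" using trancl_R by (auto simp: acyclic_def)
  then have wf: "wf ((R k)\<inverse>)" by (simp add: finite_acyclic_wf_converse)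
  have "\<exists>z. (x, z) \<in> (R k)\<^sup>* \<and> z \<notin> Domain (R k)" using wf
  proof (induction x rule: wf_induct_rule)
    case (less x)
    show ?case
    proof (cases "x \<in> Domain (R k)")
      case True
      then obtain y where y: "(x, y) \<in> R k" by auto
      then obtain z where "(y, z) \<in> (R k)\<^sup>*" "z \<notin> Domain (R k)" using less[of y] by auto
      then show ?thesis using y by (meson converse_rtrancl_into_rtrancl)
    qed auto
  qed
  then have "(x, stop x k) \<in> (R k)\<^sup>* \<and> stop x k \<notin> Domain (R k)" unfolding stop_def by (rule someI_ex)
  then show "(x, stop x k) \<in> (R k)\<^sup>*" "stop x k \<notin> Domain (R k)" by auto
qed

lemma stop_mem_ends:
  assumes "x \<in> C" "k \<in> S x" shows "(stop x k, k) \<in> ends"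
proof -
  have k: "k \<in> {0..<5}" using assms S_bounds by blast
  from stop(1)[of x k] have "stop x k \<in> C \<and> k \<in> S (stop x k)"
  proof (cases rule: rtranclE)
    case base
    then show ?thesis using assms by simp
  next
    case (step y)
    then show ?thesis using R_mem_S[OF step(2) k] bonds_nb R_subset by blast
  qed
  then show ?thesis using stop(2) by (auto simp: ends_def)
qed

text \<open>Predecessors in \<open>R k\<close> are unique, so two particles from which the same end
  is reached lie on one path back from it.\<close>

lemma stop_eq:
  assumes "stop x k = stop y k" "x \<noteq> y"
  shows "(x, y) \<in> (R k)\<^sup>+ \<or> (y, x) \<in> (R k)\<^sup>+"
proof -
  have "(stop x k, x) \<in> ((R k)\<inverse>)\<^sup>*" "(stop x k, y) \<in> ((R k)\<inverse>)\<^sup>*"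
    using stop(1)[of x k] stop(1)[of y k] assms(1) by (simp_all add: rtrancl_converse)
  then have "(x, y) \<in> ((R k)\<inverse>)\<^sup>* \<or> (y, x) \<in> ((R k)\<inverse>)\<^sup>*"
    by (rule single_valued_confluent[OF single_valued_R_converse])
  then show ?thesis using assms(2) by (auto simp: rtrancl_converse rtrancl_eq_or_trancl)
qed

lemma stop_eq_sec:
  assumes "stop x k = stop y k" "x \<noteq> y" "k \<in> {0..<5}"
  shows "sec t (y - x) = k"
proof -
  consider "(x, y) \<in> (R k)\<^sup>+" | "(y, x) \<in> (R k)\<^sup>+" using stop_eq[OF assms(1,2)] by blast
  then show ?thesis
  proof cases
    case 1
    then show ?thesis using trancl_R assms(3) by (auto simp: sec_def)
  next
    case 2
    then have "sec t (x - y) = k" using trancl_R assms(3) by (auto simp: sec_def)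
    then show ?thesis using sec_uminus[of "x - y" t] assms(2) by simp
  qed
qed

section \<open>The graph with strata as vertices and particles as edges\<close>

definition crossing :: "complex \<Rightarrow> (complex \<times> int) set" where
  "crossing x = {(stop x (k1 x), k1 x), (stop x (k2 x), k2 x)}"

lemma k_bounds: "x \<in> C \<Longrightarrow> k1 x \<in> {0..<5}" "x \<in> C \<Longrightarrow> k2 x \<in> {0..<5}"
  using k1 k2 S_bounds by blast+

lemma crossing_labels:
  assumes "x \<in> C" "crossing x = {p, q}" shows "(snd p - snd q) mod 5 \<in> {2, 3}"
proof -
  have "(snd p = k1 x \<and> snd q = k2 x) \<or> (snd p = k2 x \<and> snd q = k1 x)"
    using assms(2) by (auto simp: crossing_def doubleton_eq_iff)
  moreover have "(k2 x - k1 x) mod 5 \<in> {2, 3}"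
  proof -
    have "a mod 5 \<in> {2, 3} \<Longrightarrow> (- a) mod 5 \<in> {2, 3}" for a :: int
      unfolding insert_iff empty_iff by presburger
    from this[OF k1_k2[OF assms(1)]] show ?thesis by simp
  qed
  ultimately show ?thesis using k1_k2[OF assms(1)] by auto
qed

text \<open>If two particles shared both strata, the chord y - x would lie in the sectors
  \<open>k1 x\<close> and \<open>k2 x\<close> at once.\<close>

lemma inj_crossing: "inj_on crossing C"
proof (rule inj_onI, rule ccontr)
  fix x y assume x: "x \<in> C" and y: "y \<in> C" and eq: "crossing x = crossing y" and ne: "x \<noteq> y"
  have "(stop x (k1 x), k1 x) \<in> crossing y" "(stop x (k2 x), k2 x) \<in> crossing y"
    using eq by (auto simp: crossing_def)
  then have "stop x (k1 x) = stop y (k1 x)" "stop x (k2 x) = stop y (k2 x)"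
    by (auto simp: crossing_def)
  then have "sec t (y - x) = k1 x" "sec t (y - x) = k2 x"
    using stop_eq_sec ne k_bounds[OF x] by metis+
  then show False using k1_k2[OF x] by simp
qed

text \<open>Two numbers from {2, 3} add up to 4, 0 or 1 modulo 5, never again to 2 or 3.\<close>

lemma crossing_triangle_free:
  assumes "{u, v} \<in> crossing ` C" "{v, s} \<in> crossing ` C" "{u, s} \<in> crossing ` C"
  shows False
proof -
  have "(snd u - snd v) mod 5 \<in> {2, 3}" "(snd v - snd s) mod 5 \<in> {2, 3}" "(snd u - snd s) mod 5 \<in> {2, 3}"
    using assms crossing_labels by (metis imageE)+
  moreover have "(snd u - snd s) mod 5 = ((snd u - snd v) mod 5 + (snd v - snd s) mod 5) mod 5"
    by (simp add: mod_add_eq)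
  ultimately show False by auto
qed

section \<open>Strata attached to the substrate\<close>

definition attached :: "complex set" where
  "attached = {x \<in> C. sub_nb r0 x \<noteq> {}}"

definition foot :: "complex \<Rightarrow> complex" where
  "foot x = (SOME s. s \<in> sub_nb r0 x)"

definition feet_sec :: "complex \<Rightarrow> int" where
  "feet_sec x = sec t (foot x - x)"

lemma foot:
  assumes "x \<in> attached"
  shows "x \<in> C" "foot x \<in> sub_nb r0 x" "foot x \<in> nb r0 C x" "feet_sec x \<in> S x" "foot x \<noteq> x"
proof -
  show x: "x \<in> C" using assms by (simp add: attached_def)
  show f: "foot x \<in> sub_nb r0 x" using assms some_in_eq unfolding attached_def foot_def by blast
  then show n: "foot x \<in> nb r0 C x" using sub_nb_subset_nb posC[OF x] by blast
  show "feet_sec x \<in> S x" unfolding feet_sec_def by (rule sec_mem_S[OF x n])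
  show "foot x \<noteq> x" using n by (auto simp: nb_def)
qed

definition base_ends :: "(complex \<times> int) set" where
  "base_ends = (\<lambda>x. (stop x (feet_sec x), feet_sec x)) ` attached"

lemma base_ends_subset: "base_ends \<subseteq> ends"
  using stop_mem_ends foot by (auto simp: base_ends_def)

text \<open>All feet lie in two consecutive sectors, whose indices differ by 0, 1 or 4 modulo 5;
  hence attached strata do not cross.\<close>

lemma feet_sec_diff:
  assumes "x \<in> attached" "y \<in> attached"
  shows "(feet_sec x - feet_sec y) mod 5 \<notin> {2, 3}"
proof -
  define n where "n = \<lfloor>5 / 2 - 1 / 10 - t\<rfloor>"
  have *: "feet_sec z = n mod 5 \<or> feet_sec z = (n + 1) mod 5" if "z \<in> attached" for z
  proof -
    have "feet_sec z = sec t (z - foot z)"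
      using sec_uminus[of "z - foot z" t] foot(5)[OF that] by (simp add: feet_sec_def)
    moreover have "dsec t (z - foot z) \<in> {n mod 10, (n + 1) mod 10}"
      unfolding n_def by (rule substrate_bond_dsec[OF foot(1,2)[OF that]])
    ultimately show ?thesis by (auto simp: sec_def mod_mod_cancel)
  qed
  show ?thesis using *[OF assms(1)] *[OF assms(2)] by (elim disjE) (simp_all add: mod_diff_eq)
qed

text \<open>Suppose a chain in sector \<open>k\<close> leads from \<open>x\<close> to
  \<open>y\<close>. The bonds of the chain occupy direction k at \<open>x\<close> and k + 5 at
  \<open>y\<close>, so the feet must point in directions k + 5 and k. These are opposite, whereas
  all feet point nearly straight down.\<close>

lemma inj_base_ends: "inj_on (\<lambda>x. (stop x (feet_sec x), feet_sec x)) attached"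
proof (rule inj_onI, rule ccontr)
  have no: False if a: "x \<in> attached" "y \<in> attached" and k: "feet_sec x = k" "feet_sec y = k"
    and r: "(x, y) \<in> (R k)\<^sup>+" for x y k
  proof -
    have kb: "0 \<le> k" "k < 5" using k sec_bounds by (auto simp: feet_sec_def)
    have arith: "d = d mod 5 \<or> d = d mod 5 + 5" if "0 \<le> d" "d < 10" for d :: int
      using that by presburger
    define n where "n = \<lfloor>5 / 2 - 1 / 10 - t\<rfloor>"
    obtain y1 where y1: "(x, y1) \<in> R k" using r by (meson converse_tranclE)
    obtain y2 where y2: "(y2, y) \<in> R k" using r by (meson tranclE)
    have "y1 \<noteq> foot x" "y2 \<noteq> foot y"
      using y1 y2 bonds_nb R_subset posC foot(2)[OF a(1)] foot(2)[OF a(2)]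
      unfolding sub_nb_def substrate_def by (fastforce dest!: subsetD[OF R_subset])+
    then have "dsec t (y1 - x) \<noteq> dsec t (foot x - x)" "dsec t (y2 - y) \<noteq> dsec t (foot y - y)"
      using nb_dsec_neq foot[OF a(1)] foot[OF a(2)] y1 y2 bonds_nb R_subset by blast+
    then have "dsec t (foot x - x) \<noteq> k" "dsec t (foot y - y) \<noteq> (k + 5) mod 10"
      using R_rev[OF y2] y1 by (auto simp: R_def)
    moreover have "dsec t (foot x - x) mod 5 = k" "dsec t (foot y - y) mod 5 = k"
      using k by (auto simp: feet_sec_def sec_def)
    ultimately have "dsec t (foot x - x) = k + 5" "dsec t (foot y - y) = k"
      using kb arith[OF dsec_bounds, of t "foot x - x"] arith[OF dsec_bounds, of t "foot y - y"]
      by auto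
    then have up: "dsec t (x - foot x) = k" "dsec t (y - foot y) = k + 5"
      using dsec_uminus[of "foot x - x" t] dsec_uminus[of "foot y - y" t]
        foot(5)[OF a(1)] foot(5)[OF a(2)] kb by simp_all
    have ks: "k = n mod 10 \<or> k = (n + 1) mod 10" "k + 5 = n mod 10 \<or> k + 5 = (n + 1) mod 10"
      using substrate_bond_dsec[OF foot(1,2)[OF a(1)], of t]
        substrate_bond_dsec[OF foot(1,2)[OF a(2)], of t] unfolding up n_def by blast+
    have "(p - q) mod 10 \<in> {0, 1, 9}"
      if "q = n mod 10 \<or> q = (n + 1) mod 10" "p = n mod 10 \<or> p = (n + 1) mod 10" for p q
      using that by (elim disjE) (simp_all add: mod_diff_eq)
    from this[OF ks] show False by simp
  qed
  fix x y assume x: "x \<in> attached" and y: "y \<in> attached" and ne: "x \<noteq> y"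
    and "(stop x (feet_sec x), feet_sec x) = (stop y (feet_sec y), feet_sec y)"
  then have k: "feet_sec y = feet_sec x" "stop x (feet_sec x) = stop y (feet_sec x)" by auto
  from stop_eq[OF k(2) ne] show False using no[OF x y refl k(1)] no[OF y x k(1) refl] by blast
qed

lemma crossing_base_indep:
  assumes "u \<in> base_ends" "v \<in> base_ends" shows "{u, v} \<notin> crossing ` C"
proof
  assume "{u, v} \<in> crossing ` C"
  then have "(snd u - snd v) mod 5 \<in> {2, 3}" using crossing_labels by (metis imageE)
  then show False using assms feet_sec_diff by (auto simp: base_ends_def)
qed

lemma stop_eq_connected:
  assumes "stop x k = stop y k" shows "(x, y) \<in> bonds\<^sup>*"
proof (cases "x = y")
  case False
  have "(R k)\<^sup>+ \<subseteq> bonds\<^sup>*"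
    by (auto dest!: trancl_into_rtrancl intro: subsetD[OF rtrancl_mono[OF R_subset]])
  then show ?thesis using stop_eq[OF assms False] sym_rtrancl[OF sym_bonds] by (auto dest: symD)
qed simp

text \<open>The independent set \<open>B\<close> of the graph bound is \<open>base_ends\<close>. In
  the extreme case every particle lies on an attached stratum and is therefore joined by bonds to an
  attached particle.\<close>

lemma strata_count:
  assumes "C \<noteq> {}"
  obtains h where "1 \<le> h" "h + card attached \<le> card ends" "card C \<le> h * (card ends - h)"
    "h + card attached = card ends \<longrightarrow> (\<forall>x\<in>C. \<exists>y\<in>attached. (y, x) \<in> bonds\<^sup>*)"
proof -
  have "\<exists>u v. u \<in> ends \<and> v \<in> ends \<and> u \<noteq> v \<and> e = {u, v}" if e: "e \<in> crossing ` C" for e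
  proof -
    obtain x where x: "x \<in> C" "e = crossing x" using e by auto
    have "k1 x \<noteq> k2 x" using k1_k2[OF x(1)] by auto
    then show ?thesis using stop_mem_ends[OF x(1)] k1[OF x(1)] k2[OF x(1)] x(2)
      unfolding crossing_def by blast
  qed
  then obtain h where h: "1 \<le> h" "h + card base_ends \<le> card ends"
      "card (crossing ` C) \<le> h * (card ends - h)"
      "h + card base_ends = card ends \<longrightarrow> (\<forall>e\<in>crossing ` C. e \<inter> base_ends \<noteq> {})"
    using triangle_free_edge_bound[OF finite_ends base_ends_subset, of "crossing ` C"]
      assms crossing_base_indep crossing_triangle_free by (smt (verit) image_is_empty)
  have cb: "card base_ends = card attached"
    unfolding base_ends_def by (rule card_image[OF inj_base_ends])
  have cc: "card (crossing ` C) = card C" by (rule card_image[OF inj_crossing])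
  have "\<exists>y\<in>attached. (y, x) \<in> bonds\<^sup>*" if b: "crossing x \<inter> base_ends \<noteq> {}" for x
  proof -
    obtain k y where "y \<in> attached" "(stop x k, k) = (stop y (feet_sec y), feet_sec y)"
      using b by (auto simp: crossing_def base_ends_def)
    then show ?thesis using stop_eq_connected[of y k x] by auto
  qed
  then show thesis using h that[of h] unfolding cb cc by blast
qed

end

section \<open>Rigidity of unit bonds with exact angles\<close>

lemma theta_cis:
  assumes "x \<noteq> y" "z \<noteq> y" "cmod (x - y) = 1" "cmod (z - y) = 1"
  shows "x - y = (z - y) * cis (theta x y z)"
proof -
  obtain m where m: "Arg (x - y) = Arg (z - y) + theta x y z + 2 * pi * of_int m"
    using theta_Arg assms by blast
  have "x - y = cis (Arg (x - y))" using rcis_cmod_Arg[of "x - y"] assms(3) by (simp add: rcis_def)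
  also have "\<dots> = cis (Arg (z - y)) * cis (theta x y z)"
    using cis_multiple_2pi[of "of_int m"] by (simp add: m flip: cis_mult)
  also have "cis (Arg (z - y)) = z - y" using rcis_cmod_Arg[of "z - y"] assms(4) by (simp add: rcis_def)
  finally show ?thesis .
qed

definition units :: "complex set" where "units = {1, - 1, \<i>, - \<i>}"

lemma theta_units:
  assumes "x \<noteq> y" "z \<noteq> y" "cmod (x - y) = 1" "z - y \<in> units"
    and "theta x y z \<in> {pi / 2, pi, 3 * pi / 2}"
  shows "x - y \<in> units"
proof -
  have "cis (3 * pi / 2) = - \<i>"
    using cis_mult[of pi "pi / 2"] by (simp add: field_simps)
  then have "cis (theta x y z) = \<i> \<or> cis (theta x y z) = - 1 \<or> cis (theta x y z) = - \<i>"
    using assms(5) by (elim insertE emptyE) (simp_all del: eq_divide_eq_numeral1)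
  moreover have "cmod (z - y) = 1" using assms(4) by (auto simp: units_def)
  ultimately show ?thesis
    using theta_cis[OF assms(1,2,3)] assms(4) by (auto simp: units_def)
qed

lemma lattice_add_units: "x \<in> lattice \<Longrightarrow> u \<in> units \<Longrightarrow> x + u \<in> lattice"
  by (auto simp: lattice_def units_def)

context good_config
begin

text \<open>The condition on the bonds is what allows lattice membership to propagate from a
  particle to its neighbours.\<close>

definition aligned :: "complex \<Rightarrow> bool" where
  "aligned x \<longleftrightarrow> x \<in> lattice \<and> (\<forall>z\<in>nb r0 C x. z - x \<in> units)"

lemma exists_strata:
  obtains t S k1 k2 where "strata \<beta> \<epsilon> r0 w v3 C t S k1 k2"
    "real (\<Sum>x\<in>C. card (S x)) \<le> 2 * real (card C) + (\<Sum>(x, y, z)\<in>tri r0 C. v3 (theta x y z)) / 4"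
proof -
  obtain t where t: "real (\<Sum>x\<in>C. card (cuts t x)) \<le> (\<Sum>(x, y, z)\<in>tri r0 C. v3 (theta x y z)) / 4"
    using exists_few_cuts by blast
  define P where "P x p \<longleftrightarrow> (\<lambda>y. sec t (y - x)) ` nb r0 C x \<subseteq> fst p \<and> fst p \<subseteq> {0..<5} \<and>
    card (fst p) \<le> 2 + card (cuts t x) \<and> fst (snd p) \<in> fst p \<and> snd (snd p) \<in> fst p \<and>
    (fst (snd p) - snd (snd p)) mod 5 \<in> {2, 3}" for x and p :: "int set \<times> int \<times> int"
  have "\<exists>p. P x p" if x: "x \<in> C" for x
  proof -
    obtain S k1 k2 where "(\<lambda>y. sec t (y - x)) ` nb r0 C x \<subseteq> S" "S \<subseteq> {0..<5}"
      "card S \<le> 2 + card (cuts t x)" "k1 \<in> S" "k2 \<in> S" "(k1 - k2) mod 5 \<in> {2, 3}"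
      using exists_sectors[OF x] by metis
    then have "P x (S, k1, k2)" by (simp add: P_def)
    then show ?thesis by blast
  qed
  then have "\<exists>p. \<forall>x\<in>C. P x (p x)" by (intro bchoice) blast
  then obtain p where P: "\<forall>x\<in>C. P x (p x)" ..
  have p: "(\<lambda>y. sec t (y - x)) ` nb r0 C x \<subseteq> fst (p x)" "fst (p x) \<subseteq> {0..<5}"
    "card (fst (p x)) \<le> 2 + card (cuts t x)" "fst (snd (p x)) \<in> fst (p x)"
    "snd (snd (p x)) \<in> fst (p x)" "(fst (snd (p x)) - snd (snd (p x))) mod 5 \<in> {2, 3}"
    if "x \<in> C" for x
    using P that unfolding P_def by blast+
  have "(\<Sum>x\<in>C. card (fst (p x))) \<le> (\<Sum>x\<in>C. 2 + card (cuts t x))" using p(3) by (rule sum_mono)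
  also have "\<dots> = 2 * card C + (\<Sum>x\<in>C. card (cuts t x))"
    by (simp only: sum.distrib sum_constant) simp
  finally have "real (\<Sum>x\<in>C. card (fst (p x))) \<le> 2 * real (card C) + real (\<Sum>x\<in>C. card (cuts t x))"
    by (simp flip: of_nat_sum)
  moreover have "strata \<beta> \<epsilon> r0 w v3 C t (\<lambda>x. fst (p x)) (\<lambda>x. fst (snd (p x))) (\<lambda>x. snd (snd (p x)))"
    by unfold_locales (rule p; assumption)+
  ultimately show thesis using t
    by (intro that[of t "\<lambda>x. fst (p x)" "\<lambda>x. fst (snd (p x))" "\<lambda>x. snd (snd (p x))"]) linarith+
qed

end

context strata
begin

lemma energy_split:
  "renergy w v3 r0 \<beta> C = (\<Sum>(x, y)\<in>bonds. w (cmod (x - y))) / 2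
    + \<beta> * (\<Sum>(x, z)\<in>Sigma C (sub_nb r0). w (cmod (x - z)))
    + (\<Sum>(x, y, z)\<in>tri r0 C. v3 (theta x y z)) / 2"
proof -
  have "(\<Sum>x\<in>C. \<Sum>y\<in>C - {x}. w (cmod (x - y))) = (\<Sum>(x, y)\<in>Sigma C (\<lambda>x. C - {x}). w (cmod (x - y)))"
    using finC by (subst sum.Sigma) auto
  also have "\<dots> = (\<Sum>(x, y)\<in>bonds. w (cmod (x - y)))"
  proof (rule sum.mono_neutral_right)
    show "\<forall>p\<in>Sigma C (\<lambda>x. C - {x}) - bonds. (case p of (x, y) \<Rightarrow> w (cmod (x - y))) = 0"
      by (auto simp: bonds_def not_less intro: w_far)
  qed (use finC in \<open>auto simp: bonds_def\<close>)
  finally show ?thesis using finC by (simp add: renergy_def sum.Sigma)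
qed

lemma card_substrate_bonds: "card (Sigma C (sub_nb r0)) = card attached"
proof -
  have "card (sub_nb r0 x) = (if x \<in> attached then 1 else 0)" if "x \<in> C" for x
  proof (cases "x \<in> attached")
    case True
    then have "sub_nb r0 x = {foot x}" using substrate_bond_unique[OF that] foot(2) by blast
    then show ?thesis using True by simp
  qed (use that in \<open>simp add: attached_def\<close>)
  then have "card (Sigma C (sub_nb r0)) = (\<Sum>x\<in>C. if x \<in> attached then 1 else 0)"
    using finC by (simp add: card_SigmaI)
  also have "\<dots> = card (C \<inter> attached)" using finC by (simp add: sum.If_cases)
  also have "C \<inter> attached = attached" by (auto simp: attached_def)
  finally show ?thesis .
qed

text \<open>One bond along an axis makes all bonds at the particle do so, since they differ by exact
  quarter turns. The substrate provides the first such bond: the exact angle with the neighbour s +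
  1 of the foot \<open>s\<close> gives x = s + i.\<close>

lemma rigid_aligned:
  assumes unit_bonds: "\<And>x y. (x, y) \<in> bonds \<Longrightarrow> cmod (x - y) = 1"
    and unit_feet: "\<And>x z. x \<in> C \<Longrightarrow> z \<in> sub_nb r0 x \<Longrightarrow> cmod (x - z) = 1"
    and exact: "\<And>x y z. (x, y, z) \<in> tri r0 C \<Longrightarrow> theta x y z \<in> {pi / 2, pi, 3 * pi / 2}"
  shows "x \<in> attached \<Longrightarrow> aligned x \<and> Im x = 1"
    and "(x, y) \<in> bonds \<Longrightarrow> aligned x \<Longrightarrow> aligned y"
proof -
  have unit: "cmod (z - x) = 1" if "x \<in> C" "z \<in> nb r0 C x" for x z
  proof (cases "z \<in> C")
    case True
    then show ?thesis using that unit_bonds[of x z] by (auto simp: nb_def bonds_def norm_minus_commute)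
  next
    case False
    then show ?thesis using that unit_feet[of x z] by (auto simp: nb_def sub_nb_def norm_minus_commute)
  qed
  have al: "aligned x" if "x \<in> C" "x \<in> lattice" "u \<in> nb r0 C x" "u - x \<in> units" for x u
    unfolding aligned_def
  proof (intro conjI ballI)
    fix z assume z: "z \<in> nb r0 C x"
    show "z - x \<in> units"
    proof (cases "z = u")
      case False
      have "z \<noteq> x" "u \<noteq> x" using z that(3) by (auto simp: nb_def)
      then show ?thesis
        using theta_units[of z x u] exact mem_tri_nb[OF z that(3) False that(1)] unit[OF that(1) z] that(4)
        by blast
    qed (use that in simp)
  qed (rule that(2))
  show "aligned x \<and> Im x = 1" if x: "x \<in> attached"
  proof -
    define s where "s = foot x"
    have s: "x \<in> C" "s \<in> sub_nb r0 x" "s \<in> nb r0 C x" using foot[OF x] by (auto simp: s_def)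
    note b = substrate_bond_angle[OF s(1,2)]
    have A: "Arg (x - s) = pi / 2"
      using exact[OF b(3)] b(2,4) \<epsilon>_less pi_gt3 by (auto simp: abs_le_iff)
    have "x - s = cis (Arg (x - s))"
      using rcis_cmod_Arg[of "x - s"] unit_feet[OF s(1,2)] by (simp add: rcis_def)
    then have xs: "x - s = \<i>" unfolding A by simp
    have "s \<in> lattice" using s(2) by (simp add: sub_nb_def substrate_def)
    then have "x \<in> lattice" using lattice_add_units[of s \<i>] xs by (simp add: units_def algebra_simps)
    moreover have "s - x \<in> units" using xs by (simp add: units_def algebra_simps)
    moreover have "Im x = 1" using xs b(1) by (metis add.right_neutral diff_eq_eq imaginary_unit.sel(2) plus_complex.sel(2))
    ultimately show ?thesis using al[OF s(1) _ s(3)] by blast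
  qed
  show "aligned y" if xy: "(x, y) \<in> bonds" and "aligned x"
  proof -
    have b: "x \<in> C" "y \<in> C" "y \<in> nb r0 C x" "x \<in> nb r0 C y" using bonds_nb[OF xy] by blast+
    have u: "y - x \<in> units" and "x \<in> lattice" using \<open>aligned x\<close> b by (auto simp: aligned_def)
    then have "y \<in> lattice" using lattice_add_units[of x "y - x"] by simp
    moreover have "- u \<in> units" if "u \<in> units" for u using that by (auto simp: units_def)
    from this[OF u] have "x - y \<in> units" by simp
    ultimately show ?thesis using al b by blast
  qed
qed

end

section \<open>The energy bound for nearly right angles\<close>

context good_config
begin

lemma good_energy_bound:
  assumes "C \<noteq> {}"
  shows "- 2 * real (card C) + m_beta \<beta> (card C) / 2 \<le> renergy w v3 r0 \<beta> C"
    and "renergy w v3 r0 \<beta> C = - 2 * real (card C) + m_beta \<beta> (card C) / 2 \<Longrightarrow>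
      C \<subseteq> lattice \<and> real (card C) / real (h_star \<beta> (card C)) \<le> real (card {x \<in> C. Im x = 1})"
proof -
  let ?E = "renergy w v3 r0 \<beta> C" and ?rhs = "- 2 * real (card C) + m_beta \<beta> (card C) / 2"
  define V where "V = (\<Sum>(x, y, z)\<in>tri r0 C. v3 (theta x y z))"
  obtain t S k1 k2 where st: "strata \<beta> \<epsilon> r0 w v3 C t S k1 k2"
    and S: "real (\<Sum>x\<in>C. card (S x)) \<le> 2 * real (card C) + V / 4"
    unfolding V_def using exists_strata by blast
  interpret strata \<beta> \<epsilon> r0 w v3 C t S k1 k2 by (rule st)
  obtain h where h: "1 \<le> h" "h + card attached \<le> card ends" "card C \<le> h * (card ends - h)"
    "h + card attached = card ends \<longrightarrow> (\<forall>x\<in>C. \<exists>y\<in>attached. (y, x) \<in> bonds\<^sup>*)"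
    using strata_count[OF assms] by blast
  define Q where "Q = Sigma C (sub_nb r0)"
  define D1 where "D1 = (\<Sum>(x, y)\<in>bonds. w (cmod (x - y)) + 1)"
  define D2 where "D2 = (\<Sum>(x, z)\<in>Q. w (cmod (x - z)) + 1)"
  have finQ: "finite Q" using finC by (simp add: Q_def)
  have w1: "0 \<le> w (cmod u) + 1" for u using w_ge[of "cmod u"] by simp
  have D_nonneg: "0 \<le> D1" "0 \<le> D2" using w1 by (auto simp: D1_def D2_def intro!: sum_nonneg)
  have V_nonneg: "0 \<le> V" using v3_theta_nonneg by (auto simp: V_def intro!: sum_nonneg)
  have split1: "(\<Sum>(x, y)\<in>A. w (cmod (x - y))) = (\<Sum>(x, y)\<in>A. w (cmod (x - y)) + 1) - real (card A)" for A
    by (simp add: case_prod_unfold sum.distrib)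
  have E: "?E = D1 / 2 - real (card bonds) / 2 + \<beta> * (D2 - real (card attached)) + V / 2"
    unfolding energy_split split1 V_def D1_def D2_def Q_def[symmetric]
    using card_substrate_bonds by (simp add: Q_def diff_divide_distrib)
  define n where "n = card ends"
  define b where "b = card attached"
  define s where "s = (\<Sum>k\<in>{0..<5}. card (R k))"
  have "card bonds = 2 * s" using sum_card_R by (simp add: s_def)
  then have "real (card bonds) = 2 * real s" by simp
  moreover have "real n + real s = real (\<Sum>x\<in>C. card (S x))"
    unfolding n_def s_def of_nat_add[symmetric] card_ends ..
  \<comment> \<open>\<open>D1\<close> and \<open>D2\<close> measure how far bonds exceed the minimal
    value -1. Of V/2, the cuts consume V/4; the rest stays, so equality makes \<open>D1\<close>,
    \<open>D2\<close> and \<open>V\<close> vanish separately.\<close>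
  ultimately have E': "D1 / 2 + \<beta> * D2 + V / 4 + (- 2 * real (card C)) + (real n - \<beta> * real b) \<le> ?E"
    using E S by (simp add: b_def algebra_simps)
  have cC: "1 \<le> card C" using assms finC by (simp add: Suc_le_eq card_gt_0_iff)
  have bN: "b \<le> card C" unfolding b_def by (rule card_mono[OF finC]) (auto simp: attached_def)
  note mb = m_beta_lower_bound[OF \<beta>_pos cC h(1), of b n, folded n_def b_def, OF _ _ bN]
  have m1: "m_beta \<beta> (card C) / 2 \<le> real n - \<beta> * real b"
    using mb(1) h by (simp add: n_def b_def)
  have bD2: "0 \<le> \<beta> * D2" using D_nonneg \<beta>_pos by simp
  show "?rhs \<le> ?E" using E' m1 D_nonneg V_nonneg bD2 by linarith
  assume eq: "?E = ?rhs"
  have zero: "D1 = 0" "\<beta> * D2 = 0" "V = 0" and m2: "m_beta \<beta> (card C) / 2 = real n - \<beta> * real b"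
    using E' m1 D_nonneg V_nonneg bD2 eq by linarith+
  then have "D2 = 0" using \<beta>_pos by simp
  have hb: "h + b = n" "real (card C) / real (h_star \<beta> (card C)) \<le> real b"
    using mb(2) h m2 by (simp_all add: n_def b_def)
  have bond1: "cmod (x - y) = 1" if "(x, y) \<in> bonds" for x y
  proof -
    have "\<forall>p\<in>bonds. (case p of (x, y) \<Rightarrow> w (cmod (x - y)) + 1) = 0"
      using \<open>D1 = 0\<close> w1 unfolding D1_def by (subst (asm) sum_nonneg_eq_0_iff) auto
    then have "w (cmod (x - y)) = - 1" using that by auto
    then show ?thesis using w_min by auto
  qed
  have foot1: "cmod (x - z) = 1" if "x \<in> C" "z \<in> sub_nb r0 x" for x z
  proof -
    have "\<forall>p\<in>Q. (case p of (x, z) \<Rightarrow> w (cmod (x - z)) + 1) = 0"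
      using \<open>D2 = 0\<close> w1 finQ unfolding D2_def by (subst (asm) sum_nonneg_eq_0_iff) auto
    then have "w (cmod (x - z)) + 1 = 0" using that by (auto simp: Q_def)
    then have "w (cmod (x - z)) = - 1" by linarith
    then show ?thesis using w_min by auto
  qed
  have exact: "theta x y z \<in> {pi / 2, pi, 3 * pi / 2}" if "(x, y, z) \<in> tri r0 C" for x y z
  proof -
    have "\<forall>p\<in>tri r0 C. (case p of (x, y, z) \<Rightarrow> v3 (theta x y z)) = 0"
      using \<open>V = 0\<close> v3_theta_nonneg finC unfolding V_def by (subst (asm) sum_nonneg_eq_0_iff) auto
    then show ?thesis using that v3_zero[of "theta x y z"] theta_range[of x y z] by fastforce
  qed
  note rigid = rigid_aligned[OF bond1 foot1 exact]
  have "aligned x" if x: "x \<in> C" for x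
  proof -
    obtain y where y: "y \<in> attached" "(y, x) \<in> bonds\<^sup>*"
      using h(4) hb(1) x by (auto simp: n_def b_def)
    from y(2) show ?thesis
    proof (induction rule: rtrancl_induct)
      case base
      then show ?case using rigid(1) y(1) by blast
    next
      case (step u v)
      then show ?case using rigid(2) by blast
    qed
  qed
  then have "C \<subseteq> lattice" by (auto simp: aligned_def)
  moreover have "b \<le> card {x \<in> C. Im x = 1}"
    unfolding b_def using finC rigid(1) by (intro card_mono) (auto simp: attached_def)
  then have "real b \<le> real (card {x \<in> C. Im x = 1})" by simp
  ultimately show "C \<subseteq> lattice \<and> real (card C) / real (h_star \<beta> (card C)) \<le> real (card {x \<in> C. Im x = 1})"
    using hb(2) by linarith
qed

end

section \<open>Packing bounds\<close>

lemma cell_diameter: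
  assumes "\<lfloor>2 * Re y\<rfloor> = \<lfloor>2 * Re z\<rfloor>" "\<lfloor>2 * Im y\<rfloor> = \<lfloor>2 * Im z\<rfloor>"
  shows "cmod (y - z) < 3 / 4"
proof -
  have "\<bar>2 * Re y - 2 * Re z\<bar> < 1" "\<bar>2 * Im y - 2 * Im z\<bar> < 1" using assms by linarith+
  then have "\<bar>Re (y - z)\<bar> \<le> \<bar>1 / 2\<bar>" "\<bar>Im (y - z)\<bar> \<le> \<bar>1 / 2\<bar>"
    unfolding minus_complex.sel by linarith+
  then have "(Re (y - z))\<^sup>2 \<le> (1 / 2)\<^sup>2" "(Im (y - z))\<^sup>2 \<le> (1 / 2)\<^sup>2"
    unfolding abs_le_square_iff by blast+
  then have "(cmod (y - z))\<^sup>2 < (3 / 4)\<^sup>2" unfolding cmod_power2 by (simp add: power2_eq_square)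
  then show ?thesis by (rule power2_less_imp_less) simp
qed

text \<open>Squares of side 1/2 have diameter below 3/4, and a disc of radius 3/2 meets at most 7
  times 7 of them.\<close>

lemma card_le_cells:
  assumes fin: "finite A" and near: "\<And>y. y \<in> A \<Longrightarrow> cmod (x - y) < 3 / 2"
    and m: "\<And>y. y \<in> A \<Longrightarrow> card {z \<in> A. cmod (y - z) < 3 / 4} \<le> m"
  shows "card A \<le> 49 * m"
proof -
  define g where "g y = (\<lfloor>2 * Re y\<rfloor>, \<lfloor>2 * Im y\<rfloor>)" for y
  define I where "I a = {\<lfloor>2 * a\<rfloor> - 3..\<lfloor>2 * a\<rfloor> + 3}" for a :: real
  have gA: "g ` A \<subseteq> I (Re x) \<times> I (Im x)"
  proof
    fix p assume "p \<in> g ` A"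
    then obtain y where y: "y \<in> A" "p = g y" by auto
    have "\<bar>Re x - Re y\<bar> < 3 / 2" "\<bar>Im x - Im y\<bar> < 3 / 2"
      using near[OF y(1)] abs_Re_le_cmod[of "x - y"] abs_Im_le_cmod[of "x - y"] by auto
    then have "\<lfloor>2 * Re y\<rfloor> \<in> I (Re x)" "\<lfloor>2 * Im y\<rfloor> \<in> I (Im x)"
      unfolding I_def atLeastAtMost_iff by (intro conjI; linarith)+
    then show "p \<in> I (Re x) \<times> I (Im x)" using y by (simp add: g_def)
  qed
  have fiber: "card {y \<in> A. g y = c} \<le> m" if c: "c \<in> g ` A" for c
  proof -
    obtain y where y: "y \<in> A" "c = g y" using c by auto
    have "{z \<in> A. g z = c} \<subseteq> {z \<in> A. cmod (y - z) < 3 / 4}"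
      using cell_diameter[of y] y by (auto simp: g_def)
    then have "card {z \<in> A. g z = c} \<le> card {z \<in> A. cmod (y - z) < 3 / 4}"
      using fin by (intro card_mono) auto
    then show ?thesis using m[OF y(1)] by linarith
  qed
  have "A = (\<Union>c\<in>g ` A. {y \<in> A. g y = c})" by auto
  then have "card A \<le> (\<Sum>c\<in>g ` A. card {y \<in> A. g y = c})"
    using card_UN_le[of "g ` A" "\<lambda>c. {y \<in> A. g y = c}"] fin by simp
  also have "\<dots> \<le> card (g ` A) * m" using sum_mono[OF fiber] by simp
  also have "\<dots> \<le> card (I (Re x) \<times> I (Im x)) * m"
    using card_mono[OF _ gA] by (simp add: I_def)
  also have "\<dots> = 49 * m" by (simp add: I_def card_cartesian_product)
  finally show ?thesis .
qed

lemma lattice_small: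
  assumes "a \<in> lattice" "a \<noteq> 0" "cmod a < sqrt 2" shows "a \<in> units"
proof -
  obtain m n :: int where mn: "Re a = of_int m" "Im a = of_int n"
    using assms(1) by (auto simp: lattice_def Ints_def)
  have "(cmod a)\<^sup>2 < (sqrt 2)\<^sup>2" using assms(3) by (intro power_strict_mono) auto
  then have "real_of_int (m\<^sup>2 + n\<^sup>2) < 2" by (simp add: cmod_power2 mn)
  then have s: "m\<^sup>2 + n\<^sup>2 < 2" by linarith
  have "\<bar>k\<bar> \<le> 1" if "k\<^sup>2 < 2" for k :: int
  proof (rule ccontr)
    assume "\<not> \<bar>k\<bar> \<le> 1"
    then have "2 * 2 \<le> \<bar>k\<bar> * \<bar>k\<bar>" by (intro mult_mono) auto
    then show False using that by (simp add: power2_eq_square)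
  qed
  moreover have "m\<^sup>2 < 2" "n\<^sup>2 < 2" using s zero_le_power2[of m] zero_le_power2[of n] by linarith+
  ultimately have "\<bar>m\<bar> \<le> 1" "\<bar>n\<bar> \<le> 1" by blast+
  then have "m \<in> {-1, 0, 1}" "n \<in> {-1, 0, 1}" by auto
  moreover have "m \<noteq> 0 \<or> n \<noteq> 0" using assms(2) mn by (auto simp: complex_eq_iff)
  ultimately show ?thesis using s mn by (auto simp: units_def complex_eq_iff)
qed

lemma lattice_diff: "a \<in> lattice \<Longrightarrow> b \<in> lattice \<Longrightarrow> a - b \<in> lattice"
  by (auto simp: lattice_def)

lemma lattice_dist_ge_1:
  assumes "a \<in> lattice" "b \<in> lattice" "a \<noteq> b" shows "cmod (a - b) \<ge> 1"
proof (rule ccontr)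
  assume "\<not> cmod (a - b) \<ge> 1"
  then have "cmod (a - b) < 1" by simp
  moreover have "(1::real) < sqrt 2" by simp
  ultimately have "cmod (a - b) < sqrt 2" by linarith
  then have "a - b \<in> units"
    using lattice_small[OF lattice_diff[OF assms(1,2)]] assms(3) by simp
  then show False using \<open>cmod (a - b) < 1\<close> by (auto simp: units_def)
qed

lemma card_sub_nb_le:
  assumes "r0 \<le> 3 / 2" shows "card (sub_nb r0 x) \<le> 49"
proof -
  have "card (sub_nb r0 x) \<le> 49 * 1"
  proof (rule card_le_cells[of _ x])
    fix y assume y: "y \<in> sub_nb r0 x"
    then show "cmod (x - y) < 3 / 2" using assms by (auto simp: sub_nb_def)
    have "{z \<in> sub_nb r0 x. cmod (y - z) < 3 / 4} \<subseteq> {y}"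
      using y lattice_dist_ge_1[of y] by (force simp: sub_nb_def substrate_def)
    then show "card {z \<in> sub_nb r0 x. cmod (y - z) < 3 / 4} \<le> 1"
      using card_mono[of "{y}"] by fastforce
  qed simp
  then show ?thesis by simp
qed

text \<open>A comparison of areas: discs of radius \<open>s\<close> around \<open>P\<close> are
  disjoint and lie in the disc of radius \<open>r + s\<close> around \<open>x\<close>. With r = sqrt
  2 and s = (1 - \<epsilon>)/2 it yields the constant of (iv_3), for which the count of 49 cells is
  too weak.\<close>

lemma packing:
  fixes P :: "complex set"
  assumes fin: "finite P" and s: "s > 0" and r: "r \<ge> 0"
    and sep: "\<And>p q. p \<in> P \<Longrightarrow> q \<in> P \<Longrightarrow> p \<noteq> q \<Longrightarrow> cmod (p - q) > 2 * s"
    and near: "\<And>p. p \<in> P \<Longrightarrow> cmod (x - p) < r"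
  shows "real (card P) * s\<^sup>2 \<le> (r + s)\<^sup>2"
proof -
  define V where "V = unit_ball_vol 2"
  have V: "V > 0" by (simp add: V_def)
  have ball: "ball c \<rho> \<in> fmeasurable lborel" for c :: complex and \<rho>
    using emeasure_bounded_finite[OF bounded_ball, of c \<rho>] by (simp add: fmeasurable_def)
  have content: "measure lborel (ball c \<rho>) = V * \<rho>\<^sup>2" if "\<rho> \<ge> 0" for c :: complex and \<rho>
    using content_ball[OF that, of c] by (simp add: V_def)
  have "real (card P) * (V * s\<^sup>2) = (\<Sum>p\<in>P. measure lborel (ball p s))"
    using s by (simp add: content)
  also have "\<dots> = measure lborel (\<Union>p\<in>P. ball p s)"
  proof (rule measure_UNION'[symmetric, OF fin])
    show "pairwise (\<lambda>p q. disjnt (ball p s) (ball q s)) P"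
    proof (rule pairwiseI)
      fix p q assume "p \<in> P" "q \<in> P" "p \<noteq> q"
      then have "2 * s < dist p q" using sep by (simp add: dist_norm)
      then show "disjnt (ball p s) (ball q s)"
        unfolding disjnt_def by (intro disjoint_ballI) simp
    qed
  qed (rule ball)
  also have "\<dots> \<le> measure lborel (ball x (r + s))"
  proof (rule measure_mono_fmeasurable)
    show "(\<Union>p\<in>P. ball p s) \<subseteq> ball x (r + s)"
    proof clarify
      fix p q assume "p \<in> P" "q \<in> ball p s"
      then show "q \<in> ball x (r + s)"
        using near[of p] dist_triangle[of x q p] by (simp add: dist_norm)
    qed
    show "(\<Union>p\<in>P. ball p s) \<in> sets lborel" using fin by (auto intro: borel_open)
    show "ball x (r + s) \<in> fmeasurable lborel" by (rule ball)
  qed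
  also have "\<dots> = V * (r + s)\<^sup>2" using r s by (simp add: content)
  finally have "V * (real (card P) * s\<^sup>2) \<le> V * (r + s)\<^sup>2" by (simp add: mult_ac)
  then show ?thesis using V by simp
qed

section \<open>Removing a badly bonded particle\<close>

context potentials
begin

lemma renergy_remove:
  assumes "finite C" "x \<in> C"
  shows "renergy w v3 r0 \<beta> C = renergy w v3 r0 \<beta> (C - {x}) + (\<Sum>y\<in>C - {x}. w (cmod (x - y)))
    + \<beta> * (\<Sum>z\<in>sub_nb r0 x. w (cmod (x - z)))
    + (\<Sum>(a, b, c)\<in>tri r0 C - tri r0 (C - {x}). v3 (theta a b c)) / 2"
proof -
  define D where "D = C - {x}"
  have C: "C = insert x D" "x \<notin> D" "finite D" using assms by (auto simp: D_def)
  have "(\<Sum>a\<in>C. \<Sum>b\<in>C - {a}. w (cmod (a - b)))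
      = (\<Sum>b\<in>D. w (cmod (x - b))) + (\<Sum>a\<in>D. \<Sum>b\<in>C - {a}. w (cmod (a - b)))"
    using C by simp
  also have "(\<Sum>a\<in>D. \<Sum>b\<in>C - {a}. w (cmod (a - b)))
      = (\<Sum>a\<in>D. w (cmod (x - a)) + (\<Sum>b\<in>D - {a}. w (cmod (a - b))))"
  proof (rule sum.cong[OF refl])
    fix a assume "a \<in> D"
    then have "C - {a} = insert x (D - {a})" "x \<notin> D - {a}" using C by auto
    then show "(\<Sum>b\<in>C - {a}. w (cmod (a - b))) = w (cmod (x - a)) + (\<Sum>b\<in>D - {a}. w (cmod (a - b)))"
      using C by (simp add: norm_minus_commute)
  qed
  finally have pairs: "(\<Sum>a\<in>C. \<Sum>b\<in>C - {a}. w (cmod (a - b)))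
      = 2 * (\<Sum>b\<in>D. w (cmod (x - b))) + (\<Sum>a\<in>D. \<Sum>b\<in>D - {a}. w (cmod (a - b)))"
    by (simp add: sum.distrib)
  have feet: "(\<Sum>a\<in>C. \<Sum>z\<in>sub_nb r0 a. w (cmod (a - z)))
      = (\<Sum>z\<in>sub_nb r0 x. w (cmod (x - z))) + (\<Sum>a\<in>D. \<Sum>z\<in>sub_nb r0 a. w (cmod (a - z)))"
    using C by simp
  have "tri r0 D \<subseteq> tri r0 C" by (auto simp: tri_def triples_def D_def)
  then have angles: "(\<Sum>(a, b, c)\<in>tri r0 C. v3 (theta a b c))
      = (\<Sum>(a, b, c)\<in>tri r0 C - tri r0 D. v3 (theta a b c)) + (\<Sum>(a, b, c)\<in>tri r0 D. v3 (theta a b c))"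
    by (intro sum.subset_diff) (use assms in auto)
  show ?thesis unfolding renergy_def pairs feet angles D_def[symmetric]
    by (simp add: field_simps)
qed

lemma pair_sum_ge:
  assumes "finite A" "\<And>y. y \<in> A \<Longrightarrow> y \<noteq> x"
  shows "(\<Sum>y\<in>A. w (cmod (x - y))) \<ge>
    real (card {y \<in> A. cmod (x - y) \<le> 1 - \<epsilon>}) / \<epsilon> - real (card {y \<in> A. cmod (x - y) < r0})"
proof -
  have "real (card {y \<in> A. cmod (x - y) \<le> 1 - \<epsilon>}) / \<epsilon> - real (card {y \<in> A. cmod (x - y) < r0})
      = (\<Sum>y\<in>A. (if cmod (x - y) \<le> 1 - \<epsilon> then 1 / \<epsilon> else 0) - (if cmod (x - y) < r0 then 1 else 0))"
    using assms(1) by (simp add: sum_subtractf sum.If_cases Int_def)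
  also have "\<dots> \<le> (\<Sum>y\<in>A. w (cmod (x - y)))"
  proof (rule sum_mono)
    fix y assume "y \<in> A"
    show "(if cmod (x - y) \<le> 1 - \<epsilon> then 1 / \<epsilon> else 0) - (if cmod (x - y) < r0 then 1 else 0)
        \<le> w (cmod (x - y))"
      using w_near[of "cmod (x - y)"] w_ge[of "cmod (x - y)"] w_far[of "cmod (x - y)"] by auto
  qed
  finally show ?thesis .
qed

text \<open>Take \<open>x\<close> with the largest number d of close partners. Each cell near
  \<open>x\<close> then holds at most d + 1 particles, so \<open>x\<close> has at most 49 (d + 1)
  bonds of value at least -1, besides 49 to the substrate. As d is at least 1, their total is at
  most d (98 + 49 \<beta>), less than the repulsion d/\<epsilon>.\<close>

lemma exists_removable_close_pair:
  assumes fin: "finite C" and ne: "\<exists>x\<in>C. \<exists>y\<in>C. x \<noteq> y \<and> cmod (x - y) \<le> 1 - \<epsilon>"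
    and small: "98 + 49 * \<beta> < 1 / \<epsilon>"
  obtains x where "x \<in> C" "renergy w v3 r0 \<beta> (C - {x}) < renergy w v3 r0 \<beta> C"
proof -
  define d where "d x = card {y \<in> C - {x}. cmod (x - y) \<le> 1 - \<epsilon>}" for x
  have C0: "C \<noteq> {}" using ne by auto
  then have "Max (d ` C) \<in> d ` C" using fin by (intro Max_in) auto
  then obtain x where x: "x \<in> C" "d x = Max (d ` C)" by (metis imageE)
  have max: "d y \<le> d x" if "y \<in> C" for y using x that fin by simp
  obtain a b where ab: "a \<in> C" "b \<in> C" "a \<noteq> b" "cmod (a - b) \<le> 1 - \<epsilon>" using ne by auto
  have "d a \<noteq> 0" unfolding d_def using ab fin by (subst card_0_eq) auto
  then have d1: "1 \<le> d x" using max[OF ab(1)] by simp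
  have "card {y \<in> C - {x}. cmod (x - y) < r0} \<le> card {y \<in> C. cmod (x - y) < r0}"
    using fin by (intro card_mono) auto
  also have "\<dots> \<le> 49 * (d x + 1)"
  proof (rule card_le_cells[of _ x])
    show "finite {y \<in> C. cmod (x - y) < r0}" using fin by simp
    fix y assume y: "y \<in> {y \<in> C. cmod (x - y) < r0}"
    then show "cmod (x - y) < 3 / 2" using r0_less by auto
    have "{z \<in> {y \<in> C. cmod (x - y) < r0}. cmod (y - z) < 3 / 4}
        \<subseteq> insert y {z \<in> C - {y}. cmod (y - z) \<le> 1 - \<epsilon>}" using \<epsilon>_less by auto
    then have "card {z \<in> {y \<in> C. cmod (x - y) < r0}. cmod (y - z) < 3 / 4}
        \<le> card (insert y {z \<in> C - {y}. cmod (y - z) \<le> 1 - \<epsilon>})"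
      using fin by (intro card_mono) auto
    also have "\<dots> = d y + 1" using fin by (simp add: d_def)
    also have "\<dots> \<le> d x + 1" using max y by simp
    finally show "card {z \<in> {y \<in> C. cmod (x - y) < r0}. cmod (y - z) < 3 / 4} \<le> d x + 1" .
  qed
  finally have "real (card {y \<in> C - {x}. cmod (x - y) < r0}) \<le> real (49 * (d x + 1))"
    by (rule of_nat_mono)
  then have c: "real (card {y \<in> C - {x}. cmod (x - y) < r0}) \<le> 49 * (real (d x) + 1)" by simp
  have P: "real (d x) / \<epsilon> - 49 * (real (d x) + 1) \<le> (\<Sum>y\<in>C - {x}. w (cmod (x - y)))"
    using pair_sum_ge[of "C - {x}" x] fin c by (simp add: d_def)
  have "- 49 \<le> (\<Sum>z\<in>sub_nb r0 x. w (cmod (x - z)))"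
  proof -
    have "- real (card (sub_nb r0 x)) \<le> (\<Sum>z\<in>sub_nb r0 x. w (cmod (x - z)))"
      using sum_mono[of "sub_nb r0 x" "\<lambda>_. - 1" "\<lambda>z. w (cmod (x - z))"] w_ge by simp
    then show ?thesis using card_sub_nb_le[of r0 x] r0_less by linarith
  qed
  then have F: "\<beta> * (- 49) \<le> \<beta> * (\<Sum>z\<in>sub_nb r0 x. w (cmod (x - z)))"
    using \<beta>_pos by (intro mult_left_mono) auto
  have T: "0 \<le> (\<Sum>(a, b, c)\<in>tri r0 C - tri r0 (C - {x}). v3 (theta a b c))"
    using v3_theta_nonneg by (intro sum_nonneg) auto
  have "49 * (real (d x) + 1) + 49 * \<beta> \<le> real (d x) * (98 + 49 * \<beta>)"
  proof -
    have "1 * (49 + 49 * \<beta>) \<le> real (d x) * (49 + 49 * \<beta>)" using d1 \<beta>_pos by (intro mult_right_mono) auto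
    then show ?thesis by (simp add: algebra_simps)
  qed
  also have "\<dots> < real (d x) * (1 / \<epsilon>)" using small d1 by (intro mult_strict_left_mono) auto
  finally have "0 < real (d x) / \<epsilon> - 49 * (real (d x) + 1) + \<beta> * (- 49)" by simp
  then have "renergy w v3 r0 \<beta> (C - {x}) < renergy w v3 r0 \<beta> C"
    using renergy_remove[OF fin x(1)] P F T by linarith
  with x show thesis using that by blast
qed

text \<open>Separated particles occupy distinct cells, so bonds in \<open>C\<close> gain at most 49,
  while the substrate costs at least \<beta> (1/\<epsilon> - 49); dividing by \<beta> gives the
  threshold.\<close>

lemma exists_removable_close_foot:
  assumes fin: "finite C" and sep: "\<forall>x\<in>C. \<forall>y\<in>C. x \<noteq> y \<longrightarrow> cmod (x - y) > 1 - \<epsilon>"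
    and x: "x \<in> C" "Im x > 0" and z: "z \<in> substrate" "cmod (x - z) \<le> 1 - \<epsilon>"
    and small: "49 + 49 / \<beta> < 1 / \<epsilon>"
  shows "renergy w v3 r0 \<beta> (C - {x}) < renergy w v3 r0 \<beta> C"
proof -
  have "card {y \<in> C - {x}. cmod (x - y) < r0} \<le> 49 * 1"
  proof (rule card_le_cells[of _ x])
    show "finite {y \<in> C - {x}. cmod (x - y) < r0}" using fin by simp
    fix y assume y: "y \<in> {y \<in> C - {x}. cmod (x - y) < r0}"
    then show "cmod (x - y) < 3 / 2" using r0_less by auto
    have "{z \<in> {y \<in> C - {x}. cmod (x - y) < r0}. cmod (y - z) < 3 / 4} \<subseteq> {y}"
      using y sep \<epsilon>_less by force
    then show "card {z \<in> {y \<in> C - {x}. cmod (x - y) < r0}. cmod (y - z) < 3 / 4} \<le> 1"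
      using card_mono[of "{y}"] by fastforce
  qed
  then have "real (card {y \<in> C - {x}. cmod (x - y) < r0}) \<le> 49" by linarith
  moreover have "0 \<le> real (card {y \<in> C - {x}. cmod (x - y) \<le> 1 - \<epsilon>}) / \<epsilon>" using \<epsilon>_pos by simp
  moreover have "y \<noteq> x" if "y \<in> C - {x}" for y using that by simp
  ultimately have P: "- 49 \<le> (\<Sum>y\<in>C - {x}. w (cmod (x - y)))"
    using pair_sum_ge[of "C - {x}" x] fin by fastforce
  have "z \<in> {y \<in> sub_nb r0 x. cmod (x - y) \<le> 1 - \<epsilon>}" using z r0 \<epsilon>_pos by (auto simp: sub_nb_def)
  then have "card {y \<in> sub_nb r0 x. cmod (x - y) \<le> 1 - \<epsilon>} \<noteq> 0" by (subst card_0_eq) auto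
  then have "1 \<le> real (card {y \<in> sub_nb r0 x. cmod (x - y) \<le> 1 - \<epsilon>})" by linarith
  then have "1 / \<epsilon> \<le> real (card {y \<in> sub_nb r0 x. cmod (x - y) \<le> 1 - \<epsilon>}) / \<epsilon>"
    by (rule divide_right_mono) (use \<epsilon>_pos in simp)
  moreover have "card {y \<in> sub_nb r0 x. cmod (x - y) < r0} \<le> card (sub_nb r0 x)"
    by (intro card_mono) auto
  then have "real (card {y \<in> sub_nb r0 x. cmod (x - y) < r0}) \<le> 49"
    using card_sub_nb_le[of r0 x] r0_less by linarith
  moreover have "y \<noteq> x" if "y \<in> sub_nb r0 x" for y
    using that x by (auto simp: sub_nb_def substrate_def)
  ultimately have "1 / \<epsilon> - 49 \<le> (\<Sum>z\<in>sub_nb r0 x. w (cmod (x - z)))"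
    using pair_sum_ge[of "sub_nb r0 x" x] by fastforce
  then have F: "\<beta> * (1 / \<epsilon> - 49) \<le> \<beta> * (\<Sum>z\<in>sub_nb r0 x. w (cmod (x - z)))"
    using \<beta>_pos by (intro mult_left_mono) auto
  have "\<beta> * (49 / \<beta>) < \<beta> * (1 / \<epsilon> - 49)"
    using small \<beta>_pos by (intro mult_strict_left_mono) auto
  then have "49 < \<beta> * (1 / \<epsilon> - 49)" using \<beta>_pos by simp
  moreover have "0 \<le> (\<Sum>(a, b, c)\<in>tri r0 C - tri r0 (C - {x}). v3 (theta a b c))"
    using v3_theta_nonneg by (intro sum_nonneg) auto
  ultimately show ?thesis using renergy_remove[OF fin x(1)] P F by linarith
qed

text \<open>All relevant distances now exceed 1 - \<epsilon>, so \<open>packing\<close> bounds the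
  number of neighbours by \<open>K\<close> and the bond energy lost by \<open>M\<close>. Any member
  of the bad triple that belongs to \<open>C\<close> can be removed.\<close>

lemma exists_removable_bad_angle:
  assumes fin: "finite C" and sep: "\<forall>x\<in>C. \<forall>y\<in>C. x \<noteq> y \<longrightarrow> cmod (x - y) > 1 - \<epsilon>"
    and pos: "\<forall>x\<in>C. Im x > 0"
    and foot: "\<forall>x\<in>C. \<forall>z\<in>substrate. cmod (x - z) > 1 - \<epsilon>"
    and bad: "(a, b, c) \<in> tri r0 C" "\<not> right_angled \<epsilon> (theta a b c)"
  obtains x where "x \<in> C" "renergy w v3 r0 \<beta> (C - {x}) < renergy w v3 r0 \<beta> C"
proof -
  obtain x where x: "x \<in> C" "x \<in> {a, b, c}" using bad by (auto simp: tri_def)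
  define A where "A = {y \<in> C - {x}. cmod (x - y) < r0}"
  define P where "P = A \<union> sub_nb r0 x"
  define K where "K = (4 / (1 - \<epsilon>)\<^sup>2) * (sqrt 2 + 1/2)\<^sup>2"
  define M where "M = max 1 (2 * \<beta>) * K"
  have finA: "finite A" and finP: "finite P" using fin by (auto simp: A_def P_def)
  have disj: "A \<inter> sub_nb r0 x = {}"
    using pos by (force simp: A_def sub_nb_def substrate_def)
  have e: "0 < (1 - \<epsilon>) / 2" using \<epsilon>_less by simp
  have "real (card P) * ((1 - \<epsilon>) / 2)\<^sup>2 \<le> (sqrt 2 + (1 - \<epsilon>) / 2)\<^sup>2"
  proof (rule packing[OF finP e, of "sqrt 2" x])
    show "cmod (p - q) > 2 * ((1 - \<epsilon>) / 2)" if "p \<in> P" "q \<in> P" "p \<noteq> q" for p q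
    proof -
      have "p \<in> C \<or> p \<in> substrate" "q \<in> C \<or> q \<in> substrate"
        using that by (auto simp: P_def A_def sub_nb_def)
      moreover have "cmod (p - q) \<ge> 1" if "p \<in> substrate" "q \<in> substrate"
        using that \<open>p \<noteq> q\<close> lattice_dist_ge_1 by (auto simp: substrate_def)
      ultimately have "1 - \<epsilon> < cmod (p - q)"
        using sep foot \<open>p \<noteq> q\<close> \<epsilon>_pos by (force simp: norm_minus_commute)
      then show ?thesis by simp
    qed
    show "cmod (x - p) < sqrt 2" if "p \<in> P" for p
      using that r0 by (auto simp: P_def A_def sub_nb_def)
  qed simp
  also have "\<dots> \<le> (sqrt 2 + 1/2)\<^sup>2" using \<epsilon>_pos \<epsilon>_less by (intro power_mono) auto
  finally have "real (card P) * ((1 - \<epsilon>) / 2)\<^sup>2 \<le> (sqrt 2 + 1/2)\<^sup>2" .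
  moreover have "0 < ((1 - \<epsilon>) / 2)\<^sup>2" using e by (rule zero_less_power)
  ultimately have "real (card P) \<le> (sqrt 2 + 1/2)\<^sup>2 / ((1 - \<epsilon>) / 2)\<^sup>2"
    by (simp only: pos_le_divide_eq)
  then have PK: "real (card P) \<le> K" by (simp add: K_def power_divide mult.commute)
  have cP: "real (card A) + real (card (sub_nb r0 x)) = real (card P)"
    unfolding P_def by (subst card_Un_disjoint) (use finA disj in auto)
  have "- real (card A) \<le> (\<Sum>y\<in>C - {x}. w (cmod (x - y)))"
  proof -
    have "0 \<le> real (card {y \<in> C - {x}. cmod (x - y) \<le> 1 - \<epsilon>}) / \<epsilon>" using \<epsilon>_pos by simp
    then show ?thesis using pair_sum_ge[of "C - {x}" x] fin unfolding A_def by fastforce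
  qed
  moreover have "\<beta> * - real (card (sub_nb r0 x)) \<le> \<beta> * (\<Sum>z\<in>sub_nb r0 x. w (cmod (x - z)))"
    using sum_mono[of "sub_nb r0 x" "\<lambda>_. - 1" "\<lambda>z. w (cmod (x - z))"] w_ge \<beta>_pos
    by (intro mult_left_mono) auto
  moreover have "real (card A) + \<beta> * real (card (sub_nb r0 x)) \<le> M"
  proof -
    have "real (card A) \<le> max 1 (2 * \<beta>) * real (card A)"
      using mult_right_mono[of 1 "max 1 (2 * \<beta>)" "real (card A)"] by simp
    moreover have "\<beta> * real (card (sub_nb r0 x)) \<le> max 1 (2 * \<beta>) * real (card (sub_nb r0 x))"
      using \<beta>_pos by (intro mult_right_mono) auto
    ultimately have "real (card A) + \<beta> * real (card (sub_nb r0 x)) \<le> max 1 (2 * \<beta>) * real (card P)"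
      unfolding cP[symmetric] by (simp add: distrib_left)
    also have "\<dots> \<le> M" unfolding M_def using PK by (intro mult_left_mono) auto
    finally show ?thesis .
  qed
  moreover have "2 * M < (\<Sum>(a, b, c)\<in>tri r0 C - tri r0 (C - {x}). v3 (theta a b c))"
  proof -
    have ne: "a \<noteq> b" "c \<noteq> b" "a \<noteq> c" using bad(1) by (auto simp: tri_def triples_def)
    \<comment> \<open>The reversed triple is bad too. Each of the two contributes more than
      \<open>M\<close>, which compensates the factor 1/2 in the energy.\<close>
    have bad': "(c, b, a) \<in> tri r0 C" using bad(1) by (auto simp: tri_def triples_def norm_minus_commute)
    have nra: "\<not> right_angled \<epsilon> (theta c b a)"
      using right_angled_swap[OF ne(2,1) \<epsilon>_pos \<epsilon>_less] bad(2) by blast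
    have big: "M < v3 (theta p b q)" if "\<not> right_angled \<epsilon> (theta p b q)" for p q
      using v3_big[of "theta p b q"] theta_range[of p b q] that by (simp add: M_def K_def mult_ac)
    have "x \<notin> substrate" using pos x(1) by (auto simp: substrate_def)
    then have "{(a, b, c), (c, b, a)} \<subseteq> tri r0 C - tri r0 (C - {x})"
      using bad(1) bad' x by (auto simp: tri_def triples_def)
    then have "(\<Sum>(a, b, c)\<in>{(a, b, c), (c, b, a)}. v3 (theta a b c))
        \<le> (\<Sum>(a, b, c)\<in>tri r0 C - tri r0 (C - {x}). v3 (theta a b c))"
      using fin v3_theta_nonneg by (intro sum_mono2) auto
    moreover have "(\<Sum>(a, b, c)\<in>{(a, b, c), (c, b, a)}. v3 (theta a b c)) = v3 (theta a b c) + v3 (theta c b a)"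
      using ne by simp
    ultimately show ?thesis using big[OF bad(2)] big[OF nra] by linarith
  qed
  ultimately have "renergy w v3 r0 \<beta> (C - {x}) < renergy w v3 r0 \<beta> C"
    using renergy_remove[OF fin x(1)] by linarith
  with x show thesis using that by blast
qed

text \<open>Strong induction on the number of particles. A removal lowers the energy strictly and
  the bound does not increase with the number of particles, so equality occurs only for
  configurations without removable particles.\<close>

lemma energy_bound:
  assumes "finite C" "C \<noteq> {}" "\<And>x. x \<in> C \<Longrightarrow> Im x > 0" and small: "98 + 49 * \<beta> + 49 / \<beta> < 1 / \<epsilon>"
  shows "- 2 * real (card C) + m_beta \<beta> (card C) / 2 \<le> renergy w v3 r0 \<beta> C \<and>
    (renergy w v3 r0 \<beta> C = - 2 * real (card C) + m_beta \<beta> (card C) / 2 \<longrightarrow>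
      C \<subseteq> lattice \<and> real (card C) / real (h_star \<beta> (card C)) \<le> real (card {x \<in> C. Im x = 1}))"
  using assms(1-3)
proof (induction "card C" arbitrary: C rule: less_induct)
  case less
  have small': "98 + 49 * \<beta> < 1 / \<epsilon>" "49 + 49 / \<beta> < 1 / \<epsilon>"
    using small \<beta>_pos divide_nonneg_pos[of 49 \<beta>] by linarith+
  consider (good) "good_config \<beta> \<epsilon> r0 w v3 C"
    | (bad) x where "x \<in> C" "renergy w v3 r0 \<beta> (C - {x}) < renergy w v3 r0 \<beta> C"
  proof (cases "\<exists>x\<in>C. \<exists>y\<in>C. x \<noteq> y \<and> cmod (x - y) \<le> 1 - \<epsilon>")
    case True
    then show thesis using exists_removable_close_pair[OF less.prems(1) True small'(1)] bad by blast
  next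
    case False
    then have sep: "\<forall>x\<in>C. \<forall>y\<in>C. x \<noteq> y \<longrightarrow> cmod (x - y) > 1 - \<epsilon>" by force
    show thesis
    proof (cases "\<exists>x\<in>C. \<exists>z\<in>substrate. cmod (x - z) \<le> 1 - \<epsilon>")
      case True
      then obtain x z where "x \<in> C" "z \<in> substrate" "cmod (x - z) \<le> 1 - \<epsilon>" by blast
      then show thesis
        using exists_removable_close_foot[OF less.prems(1) sep, of x z] less.prems(3) small'(2) bad by blast
    next
      case False
      then have foot: "\<forall>x\<in>C. \<forall>z\<in>substrate. cmod (x - z) > 1 - \<epsilon>" by force
      show thesis
      proof (cases "\<exists>a b c. (a, b, c) \<in> tri r0 C \<and> \<not> right_angled \<epsilon> (theta a b c)")
        case True
        then obtain a b c where "(a, b, c) \<in> tri r0 C" "\<not> right_angled \<epsilon> (theta a b c)" by blast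
        then show thesis
          using exists_removable_bad_angle[OF less.prems(1) sep _ foot] less.prems(3) bad by metis
      next
        case False
        then show thesis using less.prems by (intro good) (unfold_locales, blast+)
      qed
    qed
  qed
  then show ?case
  proof cases
    case good
    then interpret good_config \<beta> \<epsilon> r0 w v3 C .
    show ?thesis using good_energy_bound[OF less.prems(2)] by blast
  next
    case (bad x)
    define N where "N = card (C - {x})"
    have cC: "card C = Suc N" unfolding N_def using card_Suc_Diff1[OF less.prems(1) bad(1)] by (rule sym)
    have "- 2 * real (card C) + m_beta \<beta> (card C) / 2 \<le> renergy w v3 r0 \<beta> (C - {x})"
    proof (cases "C - {x} = {}")
      case True
      \<comment> \<open>Removing the only particle leaves energy 0, while the bound for one particle
        is -\<beta>.\<close>
      then have "N = 0" by (simp only: N_def card.empty)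
      moreover have "tri r0 {} = {}" by (auto simp: tri_def)
      then have "renergy w v3 r0 \<beta> {} = 0" by (simp add: renergy_def)
      ultimately show ?thesis unfolding True using cC m_beta_1[of \<beta>] \<beta>_pos by simp
    next
      case False
      then have N1: "1 \<le> N" using less.prems(1) by (simp add: N_def Suc_le_eq card_gt_0_iff)
      have "- 2 * real N + m_beta \<beta> N / 2 \<le> renergy w v3 r0 \<beta> (C - {x})"
        using less.hyps[of "C - {x}"] less.prems False cC by (simp add: N_def)
      then show ?thesis using m_beta_Suc_le[OF \<beta>_pos N1] cC by simp
    qed
    then show ?thesis using bad(2) by linarith
  qed
qed

end

section \<open>The extended real energy\<close>

lemma theta_lattice:
  assumes "x - y \<in> units" "z - y \<in> units" "x \<noteq> z"
  shows "theta x y z \<in> {pi / 2, pi, 3 * pi / 2}"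
proof -
  have "(x - y) / (z - y) \<in> {\<i>, - 1, - \<i>}"
  proof -
    have "x - y \<noteq> z - y" using assms(3) by simp
    then show ?thesis using assms(1,2) unfolding units_def by (elim insertE emptyE) simp_all
  qed
  define t where "t = Arg ((x - y) / (z - y))"
  have "t = pi / 2 \<or> t = pi \<or> t = - pi / 2"
    using \<open>(x - y) / (z - y) \<in> {\<i>, - 1, - \<i>}\<close> Arg_of_real[of "- 1"]
    unfolding t_def by (elim insertE emptyE) simp_all
  moreover have "theta x y z = (if t < 0 then t + 2 * pi else t)"
    by (simp add: theta_def Let_def t_def)
  ultimately have "theta x y z = pi / 2 \<or> theta x y z = pi \<or> theta x y z = 3 * pi / 2"
    using pi_gt_zero by (cases "t < 0") (simp_all only: if_True if_False, linarith+)
  then show ?thesis by blast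
qed

lemma infsum_triples:
  assumes "finite C" "r0 < sqrt 2" "v3 (pi / 2) = 0" "v3 pi = 0" "v3 (3 * pi / 2) = 0"
  shows "infsum (\<lambda>(x, y, z). v3 (theta x y z)) (triples r0 C) = (\<Sum>(x, y, z)\<in>tri r0 C. v3 (theta x y z))"
proof -
  have "infsum (\<lambda>(x, y, z). v3 (theta x y z)) (triples r0 C)
      = infsum (\<lambda>(x, y, z). v3 (theta x y z)) (tri r0 C)"
  proof (rule infsum_cong_neutral)
    fix p assume p: "p \<in> triples r0 C - tri r0 C"
    obtain x y z where xyz: "p = (x, y, z)" by (cases p)
    have lat: "x \<in> lattice" "y \<in> lattice" "z \<in> lattice" and ne: "x \<noteq> y" "y \<noteq> z" "x \<noteq> z"
      and d: "cmod (x - y) < sqrt 2" "cmod (z - y) < sqrt 2"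
      using p xyz assms(2) by (auto simp: triples_def tri_def substrate_def norm_minus_commute)
    have "x - y \<in> units" "z - y \<in> units"
      using lattice_small[OF lattice_diff[OF lat(1,2)]] lattice_small[OF lattice_diff[OF lat(3,2)]] ne d
      by auto
    then show "(case p of (x, y, z) \<Rightarrow> v3 (theta x y z)) = 0"
      using theta_lattice[of x y z] ne(3) assms(3-5) xyz by (metis case_prod_conv empty_iff insert_iff)
  qed (auto simp: tri_def)
  then show ?thesis using assms(1) by simp
qed

lemma infsum_substrate:
  fixes v2 :: "real \<Rightarrow> ereal"
  assumes "\<And>r. r \<ge> r0 \<Longrightarrow> v2 r = 0"
  shows "infsum (\<lambda>z. v2 (cmod (x - z))) substrate = (\<Sum>z\<in>sub_nb r0 x. v2 (cmod (x - z)))"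
proof -
  have "infsum (\<lambda>z. v2 (cmod (x - z))) substrate = infsum (\<lambda>z. v2 (cmod (x - z))) (sub_nb r0 x)"
    by (rule infsum_cong_neutral) (auto simp: sub_nb_def not_less intro: assms)
  then show ?thesis by simp
qed

lemma energy_cases:
  fixes v2 :: "real \<Rightarrow> ereal" and w :: "real \<Rightarrow> real"
  assumes "\<beta> > 0" "finite C" "r0 < sqrt 2" "\<And>r. r \<ge> r0 \<Longrightarrow> v2 r = 0"
    and "v3 (pi / 2) = 0" "v3 pi = 0" "v3 (3 * pi / 2) = 0"
    and w: "\<And>r. r \<ge> 0 \<Longrightarrow> v2 r \<noteq> \<infinity> \<Longrightarrow> v2 r = ereal (w r)"
  shows "energy v2 v3 r0 \<beta> C = ereal (renergy w v3 r0 \<beta> C) \<or> energy v2 v3 r0 \<beta> C = \<infinity>"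
proof -
  define T where "T = (\<Sum>(x, y, z)\<in>tri r0 C. v3 (theta x y z))"
  define P where "P = (\<Sum>x\<in>C. \<Sum>y\<in>C - {x}. v2 (cmod (x - y)))"
  define Q where "Q = (\<Sum>x\<in>C. \<Sum>z\<in>sub_nb r0 x. v2 (cmod (x - z)))"
  have feet: "infsum (\<lambda>z. v2 (cmod (x - z))) substrate = (\<Sum>z\<in>sub_nb r0 x. v2 (cmod (x - z)))" for x
    by (rule infsum_substrate) (rule assms(4))
  have E: "energy v2 v3 r0 \<beta> C = ereal (1/2) * P + ereal \<beta> * Q + ereal (1/2 * T)"
    unfolding energy_def P_def Q_def T_def infsum_triples[OF assms(2,3,5,6,7)] feet ..
  have P: "P = \<infinity> \<or> P = ereal (\<Sum>x\<in>C. \<Sum>y\<in>C - {x}. w (cmod (x - y)))"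
  proof (cases "\<exists>x\<in>C. \<exists>y\<in>C - {x}. v2 (cmod (x - y)) = \<infinity>")
    case True
    then have "P = \<infinity>" unfolding P_def sum_Pinfty using assms(2) by simp
    then show ?thesis ..
  next
    case False
    then have "P = (\<Sum>x\<in>C. \<Sum>y\<in>C - {x}. ereal (w (cmod (x - y))))"
      unfolding P_def by (intro sum.cong w) auto
    then show ?thesis by simp
  qed
  have Q: "Q = \<infinity> \<or> Q = ereal (\<Sum>x\<in>C. \<Sum>z\<in>sub_nb r0 x. w (cmod (x - z)))"
  proof (cases "\<exists>x\<in>C. \<exists>z\<in>sub_nb r0 x. v2 (cmod (x - z)) = \<infinity>")
    case True
    then have "Q = \<infinity>" unfolding Q_def sum_Pinfty using assms(2) by simp
    then show ?thesis ..
  next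
    case False
    then have "Q = (\<Sum>x\<in>C. \<Sum>z\<in>sub_nb r0 x. ereal (w (cmod (x - z))))"
      unfolding Q_def by (intro sum.cong w) auto
    then show ?thesis by simp
  qed
  show ?thesis
  proof (cases "P = \<infinity> \<or> Q = \<infinity>")
    case True
    then have "energy v2 v3 r0 \<beta> C = \<infinity>" unfolding E using P Q assms(1) by auto
    then show ?thesis ..
  next
    case False
    then show ?thesis unfolding E renergy_def T_def using P Q by simp
  qed
qed

text \<open>The value 1/\<epsilon> + 1 in place of infinity respects every condition on
  \<open>w\<close>. Nothing is lost: by \<open>energy_cases\<close> the energy either equals
  \<open>renergy\<close> or is infinite, and then both claims are trivial.\<close>

lemma pot_conditions_potentials:
  assumes "\<beta> > 0" "0 < \<epsilon>" "\<epsilon> < 1 / 20" "pot_conditions \<beta> \<epsilon> r0 v2 v3"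
    and w: "w = (\<lambda>r. if v2 r = \<infinity> then 1 / \<epsilon> + 1 else real_of_ereal (v2 r))"
  shows "potentials \<beta> \<epsilon> r0 w v3" "\<And>r. r \<ge> 0 \<Longrightarrow> v2 r \<noteq> \<infinity> \<Longrightarrow> v2 r = ereal (w r)"
proof -
  note pc = assms(4)[unfolded pot_conditions_def]
  show fin: "v2 r = ereal (w r)" if "r \<ge> 0" "v2 r \<noteq> \<infinity>" for r
  proof -
    have "- 1 \<le> v2 r" using pc that by blast
    then have "v2 r \<noteq> - \<infinity>" by auto
    then show ?thesis using that by (cases "v2 r") (simp_all add: w)
  qed
  have e: "0 < 1 / \<epsilon>" using assms(2) by simp
  have inf: "w r = 1 / \<epsilon> + 1" if "v2 r = \<infinity>" for r using that by (simp add: w)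
  show "potentials \<beta> \<epsilon> r0 w v3"
  proof
    show "\<beta> > 0" "\<epsilon> > 0" "\<epsilon> < 1 / 20" by (rule assms)+
    show "1 < r0" "r0 < sqrt 2" using pc by blast+
    show "- 1 \<le> w r" if r: "r \<ge> 0" for r
    proof (cases "v2 r = \<infinity>")
      case True
      then show ?thesis using inf[of r] e by linarith
    next
      case False
      have "- 1 \<le> v2 r" using pc r by blast
      then show ?thesis using fin[OF r False] by (simp add: one_ereal_def)
    qed
    show "r = 1" if r: "r \<ge> 0" "w r = - 1" for r
    proof (rule ccontr)
      assume "r \<noteq> 1"
      then have "- 1 < v2 r" using pc r by blast
      moreover have "v2 r \<noteq> \<infinity>"
      proof
        assume "v2 r = \<infinity>"
        then show False using inf[of r] r(2) e by linarith
      qed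
      ultimately show False using fin[OF r(1)] r(2) by (simp add: one_ereal_def)
    qed
    show "w r = 0" if "r0 \<le> r" for r
    proof -
      have "v2 r = 0" using pc that by blast
      then show ?thesis by (simp add: w)
    qed
    show "1 / \<epsilon> < w r" if r: "0 \<le> r" "r \<le> 1 - \<epsilon>" for r
    proof (cases "v2 r = \<infinity>")
      case False
      have "ereal (1 / \<epsilon>) < v2 r" using pc r by blast
      then show ?thesis using fin[OF r(1) False] by simp
    qed (simp add: inf)
    show "0 \<le> v3 \<phi>" if "0 \<le> \<phi>" "\<phi> \<le> 2 * pi" for \<phi>
    proof (cases "\<phi> \<in> {pi / 2, pi, 3 * pi / 2}")
      case True
      moreover have "v3 (pi / 2) = 0" "v3 pi = 0" "v3 (3 * pi / 2) = 0" using pc by blast+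
      ultimately have "v3 \<phi> = 0" by (elim insertE emptyE) (simp_all only:)
      then show ?thesis by simp
    next
      case False
      then have "0 < v3 \<phi>" using pc that by blast
      then show ?thesis by simp
    qed
    show "\<phi> \<in> {pi / 2, pi, 3 * pi / 2}" if "0 \<le> \<phi>" "\<phi> \<le> 2 * pi" "v3 \<phi> = 0" for \<phi>
    proof (rule ccontr)
      assume "\<phi> \<notin> {pi / 2, pi, 3 * pi / 2}"
      then have "0 < v3 \<phi>" using pc that(1,2) by blast
      then show False using that(3) by simp
    qed
    show "4 / (pi / 10 - \<epsilon>) * \<bar>\<phi> - pi\<bar> \<le> v3 \<phi>" if "\<bar>\<phi> - pi\<bar> \<le> \<epsilon>" for \<phi>
    proof -
      have "pi - \<epsilon> \<le> \<phi>" "\<phi> \<le> pi + \<epsilon>" using that by (auto simp: abs_le_iff)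
      then show ?thesis using pc by blast
    qed
    show "max 1 (2 * \<beta>) * (4 / (1 - \<epsilon>)\<^sup>2) * (sqrt 2 + 1 / 2)\<^sup>2 < v3 \<phi>"
      if "0 \<le> \<phi>" "\<phi> \<le> 2 * pi" "\<not> right_angled \<epsilon> \<phi>" for \<phi>
    proof -
      have "\<phi> \<notin> {pi / 2 - \<epsilon>..pi / 2 + \<epsilon>}" "\<phi> \<notin> {pi - \<epsilon>..pi + \<epsilon>}"
        "\<phi> \<notin> {3 * pi / 2 - \<epsilon>..3 * pi / 2 + \<epsilon>}"
        using that(3) unfolding right_angled_def by (auto simp: abs_le_iff)
      then show ?thesis using pc that(1,2) by blast
    qed
  qed
qed

theorem theorem2p1:
  fixes \<beta> :: real
  assumes "\<beta> > 0"
  shows "\<exists>\<epsilon>0 > 0. \<forall>\<epsilon> r0 (v2 :: real \<Rightarrow> ereal) (v3 :: real \<Rightarrow> real).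
           0 < \<epsilon> \<and> \<epsilon> < \<epsilon>0 \<and> pot_conditions \<beta> \<epsilon> r0 v2 v3 \<longrightarrow>
           (\<exists>N\<beta> :: nat. \<forall>N C. N \<ge> N\<beta> \<and> is_config N C \<longrightarrow>
              energy v2 v3 r0 \<beta> C \<ge> ereal (- 2 * real N + m_beta \<beta> N / 2) \<and>
              (energy v2 v3 r0 \<beta> C = ereal (- 2 * real N + m_beta \<beta> N / 2) \<longrightarrow>
                 C \<subseteq> {x \<in> lattice. Im x > 0} \<and>
                 real (card {x \<in> C. Im x = 1}) \<ge> real N / real (h_star \<beta> N)))"
proof -
  \<comment> \<open>Large enough for both repulsion thresholds in the removal lemmas; being above
    98, it also forces \<epsilon> < 1/20.\<close>
  define K where "K = 98 + 49 * \<beta> + 49 / \<beta>"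
  have K: "K > 98" using assms by (simp add: K_def add_pos_pos)
  show ?thesis
  proof (rule exI[of _ "1 / K"], intro conjI allI impI)
    show "0 < 1 / K" using K by simp
    fix \<epsilon> r0 and v2 :: "real \<Rightarrow> ereal" and v3 :: "real \<Rightarrow> real"
    assume a: "0 < \<epsilon> \<and> \<epsilon> < 1 / K \<and> pot_conditions \<beta> \<epsilon> r0 v2 v3"
    have \<epsilon>K: "K < 1 / \<epsilon>" using a K by (simp add: field_simps)
    have "1 / K < 1 / 20" using K by (simp add: field_simps)
    with a have \<epsilon>20: "\<epsilon> < 1 / 20" by linarith
    define w where "w = (\<lambda>r. if v2 r = \<infinity> then 1 / \<epsilon> + 1 else real_of_ereal (v2 r))"
    note pot = pot_conditions_potentials[OF assms conjunct1[OF a] \<epsilon>20 conjunct2[OF conjunct2[OF a]] w_def]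
    interpret potentials \<beta> \<epsilon> r0 w v3 by (rule pot(1))
    show "\<exists>N\<beta> :: nat. \<forall>N C. N \<ge> N\<beta> \<and> is_config N C \<longrightarrow>
              energy v2 v3 r0 \<beta> C \<ge> ereal (- 2 * real N + m_beta \<beta> N / 2) \<and>
              (energy v2 v3 r0 \<beta> C = ereal (- 2 * real N + m_beta \<beta> N / 2) \<longrightarrow>
                 C \<subseteq> {x \<in> lattice. Im x > 0} \<and>
                 real (card {x \<in> C. Im x = 1}) \<ge> real N / real (h_star \<beta> N))"
    \<comment> \<open>Every nonempty configuration is covered; for N = 0 the minimum would range
      over the empty set.\<close>
    proof (rule exI[of _ 1], intro allI impI)
      fix N C assume NC: "N \<ge> 1 \<and> is_config N C"
      then have C: "finite C" "card C = N" "\<And>x. x \<in> C \<Longrightarrow> Im x > 0" "C \<noteq> {}"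
        by (auto simp: is_config_def)
      have "v2 r = 0" if "r \<ge> r0" for r using a that unfolding pot_conditions_def by blast
      moreover have "v3 (pi / 2) = 0" "v3 pi = 0" "v3 (3 * pi / 2) = 0"
        using a unfolding pot_conditions_def by blast+
      ultimately have "energy v2 v3 r0 \<beta> C = ereal (renergy w v3 r0 \<beta> C) \<or> energy v2 v3 r0 \<beta> C = \<infinity>"
        using energy_cases[OF assms C(1) r0(2)] pot(2) by presburger
      moreover have "- 2 * real N + m_beta \<beta> N / 2 \<le> renergy w v3 r0 \<beta> C \<and>
          (renergy w v3 r0 \<beta> C = - 2 * real N + m_beta \<beta> N / 2 \<longrightarrow>
            C \<subseteq> lattice \<and> real N / real (h_star \<beta> N) \<le> real (card {x \<in> C. Im x = 1}))"
        using energy_bound[OF C(1,4,3)] \<epsilon>K C(2) by (simp add: K_def)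
      ultimately show "energy v2 v3 r0 \<beta> C \<ge> ereal (- 2 * real N + m_beta \<beta> N / 2) \<and>
              (energy v2 v3 r0 \<beta> C = ereal (- 2 * real N + m_beta \<beta> N / 2) \<longrightarrow>
                 C \<subseteq> {x \<in> lattice. Im x > 0} \<and>
                 real (card {x \<in> C. Im x = 1}) \<ge> real N / real (h_star \<beta> N))"
        using C(3) by auto
    qed
  qed
qed

end
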